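(* Let $Y,Z$ be rearrangement invariant Banach function spaces and $X=Y^{1/2}Z^{1/2}$. Assume that $B$ is a rearrangement invariant Banach function space such that, for some constant $C>0$, $$\|\nabla u\|_{B}\leq C\,\|\nabla^2 u\|_Y^{\frac{1}{2}}\|u\|_Z^{\frac{1}{2}}$$ holds for all $u\in W^{2,1}_{\mathrm{loc}}(\mathbb{R}^d)\cap Z$. (i) If $Z\cap L^{\infty}\subset Y\cap L^{\infty}$, then $X\cap L^{\infty}\subset B\cap L^{\infty}$. (ii) If $Z\cap L^{1}\subset Y\cap L^{1}$, then $X\cap L^{1}\subset B\cap L^{1}$.
   Context: A Banach function space (B.f. space) over $(0,\infty)$ with Lebesgue measure is a Banach space $X$ of a.e. finite measurable functions with the ideal property ($|f|\le g$, $g\in X$ implies $f\in X$, $\|f\|_X\le\|g\|_X$) and the Fatou property ($0\le f_n\uparrow f$ a.e., $\sup_n\|f_n\|_X<\infty$ implies $f\in X$, $\|f\|_X=\sup_n\|f_n\|_X$). It is rearrangement invariant if equimeasurable functions have equal norms. All spaces are considered over $(0,\infty)$; for a measurable $f$ on $\mathbb{R}^d$, $f^*$ denotes its nonincreasing rearrangement, $\|f\|_X:=\|f^*\|_X$ and $f\in X$ means $f^*\in X$. Derivatives are distributional, $|\nabla^k u|:=\sum_{|\alpha|=k}|\partial^\alpha u|$, $\|\nabla^k u\|_X:=\||\nabla^k u|\|_X$. The Calderón–Lozanovskii space $Y^{1/2}Z^{1/2}$ consists of all $f$ with $|f|\le g^{1/2}h^{1/2}$ for some $0\le g\in Y$,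 $0\le h\in Z$, normed by $\inf\max\{\|g\|_Y,\|h\|_Z\}$ over such representations. *)

theory Defs
  imports "HOL-Analysis.Analysis"
begin

text \<open>A Banach function space X over (0,inf) (with Lebesgue measure) is represented by
its norm N, extended by the value infinity: X consists of the Lebesgue measurable
functions f on (0,inf) (values outside (0,inf) are irrelevant) with N f < infinity.\<close>

abbreviation M0 :: "real measure" where
  "M0 \<equiv> lebesgue_on {0<..}"

definition bfs_mem :: "((real \<Rightarrow> real) \<Rightarrow> ennreal) \<Rightarrow> (real \<Rightarrow> real) \<Rightarrow> bool" where
  "bfs_mem N f \<longleftrightarrow> f \<in> borel_measurable M0 \<and> N f < \<infinity>"

definition is_bfs :: "((real \<Rightarrow> real) \<Rightarrow> ennreal) \<Rightarrow> bool" where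
  "is_bfs N \<longleftrightarrow>
    \<comment> \<open>norm axioms\<close>
    (\<forall>f. f \<in> borel_measurable M0 \<longrightarrow> (N f = 0 \<longleftrightarrow> (AE x in M0. f x = 0))) \<and>
    (\<forall>f c. f \<in> borel_measurable M0 \<longrightarrow> N (\<lambda>x. c * f x) = ennreal \<bar>c\<bar> * N f) \<and>
    (\<forall>f g. f \<in> borel_measurable M0 \<longrightarrow> g \<in> borel_measurable M0 \<longrightarrow>
        N (\<lambda>x. f x + g x) \<le> N f + N g) \<and>
    \<comment> \<open>ideal property (lattice property of the norm)\<close>
    (\<forall>f g. f \<in> borel_measurable M0 \<longrightarrow> g \<in> borel_measurable M0 \<longrightarrow>
        (AE x in M0. \<bar>f x\<bar> \<le> \<bar>g x\<bar>) \<longrightarrow> N f \<le> N g) \<and>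
    \<comment> \<open>Fatou property\<close>
    (\<forall>fs f. (\<forall>n. fs n \<in> borel_measurable M0) \<longrightarrow> f \<in> borel_measurable M0 \<longrightarrow>
        (AE x in M0. (\<forall>n. 0 \<le> fs n x \<and> fs n x \<le> fs (Suc n) x) \<and>
                     (\<lambda>n. fs n x) \<longlonglongrightarrow> f x) \<longrightarrow>
        N f = (SUP n. N (fs n))) \<and>
    \<comment> \<open>completeness (Banach space)\<close>
    (\<forall>fs. (\<forall>n. bfs_mem N (fs n)) \<longrightarrow>
        (\<forall>e>0. \<exists>K. \<forall>m\<ge>K. \<forall>n\<ge>K. N (\<lambda>x. fs m x - fs n x) < ennreal e) \<longrightarrow>
        (\<exists>f. bfs_mem N f \<and> (\<lambda>n. N (\<lambda>x. fs n x - f x)) \<longlonglongrightarrow> 0))"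

definition distr0 :: "(real \<Rightarrow> real) \<Rightarrow> real \<Rightarrow> ennreal" where
  "distr0 f s = emeasure M0 {x \<in> {0<..}. s < \<bar>f x\<bar>}"

definition is_ri_bfs :: "((real \<Rightarrow> real) \<Rightarrow> ennreal) \<Rightarrow> bool" where
  "is_ri_bfs N \<longleftrightarrow> is_bfs N \<and>
    (\<forall>f g. f \<in> borel_measurable M0 \<longrightarrow> g \<in> borel_measurable M0 \<longrightarrow>
       (\<forall>s\<ge>0. distr0 f s = distr0 g s) \<longrightarrow> N f = N g)"

definition CL_mem :: "((real \<Rightarrow> real) \<Rightarrow> ennreal) \<Rightarrow> ((real \<Rightarrow> real) \<Rightarrow> ennreal)
    \<Rightarrow> (real \<Rightarrow> real) \<Rightarrow> bool" where
  "CL_mem Y Z f \<longleftrightarrow> f \<in> borel_measurable M0 \<and>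
     (\<exists>g h. bfs_mem Y g \<and> bfs_mem Z h \<and> (\<forall>x\<in>{0<..}. 0 \<le> g x \<and> 0 \<le> h x) \<and>
        (AE x in M0. \<bar>f x\<bar> \<le> sqrt (g x) * sqrt (h x)))"

definition Linf_mem :: "(real \<Rightarrow> real) \<Rightarrow> bool" where
  "Linf_mem f \<longleftrightarrow> f \<in> borel_measurable M0 \<and> (\<exists>c. AE x in M0. \<bar>f x\<bar> \<le> c)"

definition L1_mem :: "(real \<Rightarrow> real) \<Rightarrow> bool" where
  "L1_mem f \<longleftrightarrow> integrable M0 f"

definition distr :: "('a::euclidean_space \<Rightarrow> real) \<Rightarrow> real \<Rightarrow> ennreal" where
  "distr u s = emeasure lebesgue {x. s < \<bar>u x\<bar>}"

definition rearr :: "('a::euclidean_space \<Rightarrow> real) \<Rightarrow> real \<Rightarrow> ennreal" where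
  "rearr u t = (INF s \<in> {s::real. 0 \<le> s \<and> distr u s \<le> ennreal t}. ennreal s)"

definition rnorm :: "((real \<Rightarrow> real) \<Rightarrow> ennreal) \<Rightarrow> ('a::euclidean_space \<Rightarrow> real) \<Rightarrow> ennreal" where
  "rnorm N u = (if \<forall>t>0. rearr u t < \<infinity> then N (\<lambda>t. enn2real (rearr u t)) else \<infinity>)"

definition rmem :: "((real \<Rightarrow> real) \<Rightarrow> ennreal) \<Rightarrow> ('a::euclidean_space \<Rightarrow> real) \<Rightarrow> bool" where
  "rmem N u \<longleftrightarrow> u \<in> borel_measurable lebesgue \<and> rnorm N u < \<infinity>"

definition ennsqrt :: "ennreal \<Rightarrow> ennreal" where
  "ennsqrt a = (if a = \<infinity> then \<infinity> else ennreal (sqrt (enn2real a)))"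

definition partial :: "'n::finite \<Rightarrow> (real^'n \<Rightarrow> real) \<Rightarrow> real^'n \<Rightarrow> real" where
  "partial i f x = deriv (\<lambda>t. f (x + t *\<^sub>R axis i 1)) 0"

fun iter_partial :: "'n::finite list \<Rightarrow> (real^'n \<Rightarrow> real) \<Rightarrow> real^'n \<Rightarrow> real" where
  "iter_partial [] f = f"
| "iter_partial (i # is) f = partial i (iter_partial is f)"

definition test_fn :: "(real^'n::finite \<Rightarrow> real) \<Rightarrow> bool" where
  "test_fn \<phi> \<longleftrightarrow> compact (closure {x. \<phi> x \<noteq> 0}) \<and>
     (\<forall>is. continuous_on UNIV (iter_partial is \<phi>) \<and>
        (\<forall>x i. (\<lambda>t. iter_partial is \<phi> (x + t *\<^sub>R axis i 1)) field_differentiable (at 0)))"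

definition loc_int :: "(real^'n::finite \<Rightarrow> real) \<Rightarrow> bool" where
  "loc_int u \<longleftrightarrow> (\<forall>K. compact K \<longrightarrow> set_integrable lebesgue K u)"

text \<open>Multi-indices alpha :: 'n => nat, order |alpha| = sum alpha UNIV.
v is the weak derivative d^alpha u (the classical d^alpha phi is computed along any
list of directions in which each i occurs alpha i times).\<close>
definition weak_deriv :: "(real^'n::finite \<Rightarrow> real) \<Rightarrow> ('n \<Rightarrow> nat) \<Rightarrow> (real^'n \<Rightarrow> real) \<Rightarrow> bool" where
  "weak_deriv u \<alpha> v \<longleftrightarrow>
     (\<forall>\<phi> is. test_fn \<phi> \<longrightarrow> (\<forall>i. count_list is i = \<alpha> i) \<longrightarrow>
        (\<integral>x. u x * iter_partial is \<phi> x \<partial>lebesgue)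
          = (-1) ^ (sum \<alpha> UNIV) * (\<integral>x. v x * \<phi> x \<partial>lebesgue))"

definition W21loc_with :: "(real^'n::finite \<Rightarrow> real) \<Rightarrow> (('n \<Rightarrow> nat) \<Rightarrow> real^'n \<Rightarrow> real) \<Rightarrow> bool" where
  "W21loc_with u D \<longleftrightarrow> loc_int u \<and>
     (\<forall>\<alpha>. sum \<alpha> UNIV \<le> 2 \<longrightarrow> loc_int (D \<alpha>) \<and> weak_deriv u \<alpha> (D \<alpha>))"

definition grad_abs :: "nat \<Rightarrow> (('n::finite \<Rightarrow> nat) \<Rightarrow> real^'n \<Rightarrow> real) \<Rightarrow> real^'n \<Rightarrow> real" where
  "grad_abs k D x = (\<Sum>\<alpha>\<in>{\<alpha>. sum \<alpha> UNIV = k}. \<bar>D \<alpha> x\<bar>)"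

end

theory Submission
  imports Defs
begin

text \<open>Let g and h be step functions with values a k and b k on sets of measure m k. Let u be a sum of
disjoint bumps, those for the value k having width about l * sqrt (b k / a k) in one fixed
direction and height width * sqrt (a k * b k), spread over a set of measure m k. For small l the
derivative in this direction dominates all others, so that u, its gradient and its second
derivatives have, up to constants, the rearrangements of l * h, sqrt (g * h) and g / l. The
parameter l cancels in the product of the two norms on the right-hand side, which bounds the
B-norm of sqrt (g * h) by the square roots of the norms of g and h. The Fatou property extends
this from simple functions to all g and h.\<close>

section \<open>Rearrangements\<close>

text \<open>A bump of width w and height w * f with f = sqrt (a * b) has size w * f, gradient of
  size f and second derivatives of size f / w. The choice w = l * sqrt (b / a) turns the outer two
  into l * b and a / l, so each norm on the right sees only its own function. One l must serve all
  steps and make every w at most 1 and at most the measure of its step; hence finitely many steps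
  come first, cut into pieces of this width up to a factor 2. All bumps stand in a row in a strip
  over one axis, with cross-section the unit cube: a piece of measure m carries a bump of width m,
  and one coordinate decides disjointness. The derivative of a bump vanishes at its peak and edges,
  so the gradient is bounded below only on a part of the cell, whose measure is smaller by 4^d. This
  loss is recovered by the triangle inequality for 4^d equimeasurable copies. The constant 12000^d
  collects 3^d from upper bounds on the bumps, 1000^d from lower bounds and 4^d from this loss;
  under the root stand 2 from rounding and the number of second-order multi-indices.\<close>

definition dist_fn :: "'a measure \<Rightarrow> ('a \<Rightarrow> real) \<Rightarrow> real \<Rightarrow> ennreal" where
  "dist_fn M f s = emeasure M {x \<in> space M. s < \<bar>f x\<bar>}"

text \<open>The generalised inverse of a nonincreasing m, split off from \<open>rearr\<close> so
  that distribution functions over R^d and over the half-line are compared through the same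
  inverse.\<close>

definition dist_inv :: "(real \<Rightarrow> ennreal) \<Rightarrow> real \<Rightarrow> ennreal" where
  "dist_inv m t = (INF s \<in> {s::real. 0 \<le> s \<and> m s \<le> ennreal t}. ennreal s)"

lemma distr_eq_dist_fn: "distr u = dist_fn lebesgue u"
  by (simp add: fun_eq_iff distr_def dist_fn_def)

lemma distr0_eq_dist_fn: "distr0 f = dist_fn M0 f"
  by (simp add: fun_eq_iff distr0_def dist_fn_def)

lemma rearr_eq_dist_inv: "rearr u = dist_inv (distr u)"
  by (simp add: fun_eq_iff rearr_def dist_inv_def)

lemma dist_fn_antimono:
  assumes "f \<in> borel_measurable M" "s \<le> s'"
  shows "dist_fn M f s' \<le> dist_fn M f s"
  unfolding dist_fn_def using assms by (intro emeasure_mono) auto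

lemma dist_fn_mono:
  assumes "f \<in> borel_measurable M" "g \<in> borel_measurable M"
    and "\<And>x. x \<in> space M \<Longrightarrow> \<bar>f x\<bar> \<le> \<bar>g x\<bar>"
  shows "dist_fn M f s \<le> dist_fn M g s"
  unfolding dist_fn_def using assms by (intro emeasure_mono) (auto intro: less_le_trans)

text \<open>The superlevel set at s is the increasing union of those at s + 1/(n+1). Since
  \<open>dist_fn\<close> is nonincreasing, this one-sided bound is all of right-continuity.\<close>

lemma dist_fn_right_cont:
  assumes f: "f \<in> borel_measurable M" and le: "\<And>s'. s < s' \<Longrightarrow> dist_fn M f s' \<le> c"
  shows "dist_fn M f s \<le> c"
proof -
  let ?A = "\<lambda>n. {x \<in> space M. s + 1 / real (Suc n) < \<bar>f x\<bar>}"
  have un: "{x \<in> space M. s < \<bar>f x\<bar>} = (\<Union>n. ?A n)"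
  proof (intro equalityI subsetI)
    fix x assume "x \<in> {x \<in> space M. s < \<bar>f x\<bar>}"
    then have x: "x \<in> space M" "0 < \<bar>f x\<bar> - s" by auto
    then obtain n where "1 / real (Suc n) < \<bar>f x\<bar> - s"
      using nat_approx_posE by blast
    with x show "x \<in> (\<Union>n. ?A n)" by (auto intro!: exI[of _ n])
  next
    fix x assume "x \<in> (\<Union>n. ?A n)"
    then obtain n where "x \<in> space M" "s + 1 / real (Suc n) < \<bar>f x\<bar>" by auto
    moreover have "0 < 1 / real (Suc n)" by simp
    ultimately show "x \<in> {x \<in> space M. s < \<bar>f x\<bar>}"
      by (smt (verit) mem_Collect_eq)
  qed
  have inc: "incseq ?A"
  proof (rule incseq_SucI)
    fix n show "?A n \<subseteq> ?A (Suc n)"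
    proof
      fix x assume "x \<in> ?A n"
      moreover have "1 / real (Suc (Suc n)) \<le> 1 / real (Suc n)" by (simp add: field_simps)
      ultimately show "x \<in> ?A (Suc n)" by auto
    qed
  qed
  have "dist_fn M f s = (SUP n. emeasure M (?A n))"
    unfolding dist_fn_def un using f inc by (intro SUP_emeasure_incseq[symmetric]) auto
  also have "\<dots> \<le> c"
    using le by (intro SUP_least) (auto simp: dist_fn_def)
  finally show ?thesis .
qed

text \<open>A Galois connection: right-continuity \<open>rc\<close> gives the forward direction.
  Measurability and equimeasurability of the rearrangement are read off from it.\<close>

lemma dist_inv_le_iff:
  assumes anti: "\<And>s s'. s \<le> s' \<Longrightarrow> m s' \<le> m s"
    and rc: "\<And>s c. (\<And>s'. s < s' \<Longrightarrow> m s' \<le> c) \<Longrightarrow> m s \<le> c"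
    and s: "0 \<le> s"
  shows "dist_inv m t \<le> ennreal s \<longleftrightarrow> m s \<le> ennreal t"
proof
  assume le: "dist_inv m t \<le> ennreal s"
  show "m s \<le> ennreal t"
  proof (rule rc)
    fix s' assume s': "s < s'"
    then have "ennreal s < ennreal s'" using s by (simp add: ennreal_less_iff)
    then have "dist_inv m t < ennreal s'" using le by (rule le_less_trans[rotated])
    then obtain r where r: "0 \<le> r" "m r \<le> ennreal t" "ennreal r < ennreal s'"
      unfolding dist_inv_def INF_less_iff by auto
    then have "r \<le> s'" by (simp add: ennreal_less_iff)
    then show "m s' \<le> ennreal t" using anti r(2) order_trans by blast
  qed
next
  assume "m s \<le> ennreal t"
  then show "dist_inv m t \<le> ennreal s" using s unfolding dist_inv_def by (intro INF_lower) auto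
qed

lemma dist_inv_mono:
  assumes "\<And>s. 0 \<le> s \<Longrightarrow> m s \<le> m' s"
  shows "dist_inv m t \<le> dist_inv m' t"
  unfolding dist_inv_def by (rule INF_superset_mono) (auto intro: order_trans[OF assms])

lemma dist_inv_dist_fn_le_iff:
  assumes "f \<in> borel_measurable M" "0 \<le> s"
  shows "dist_inv (dist_fn M f) t \<le> ennreal s \<longleftrightarrow> dist_fn M f s \<le> ennreal t"
  by (rule dist_inv_le_iff)
    (use assms in \<open>auto intro: dist_fn_antimono dist_fn_right_cont\<close>)

text \<open>For a >= 0 the sublevel sets are half-lines or empty by the Galois connection.
  Finiteness keeps \<open>enn2real\<close> from sending infinity to 0.\<close>

lemma borel_measurable_dist_inv:
  assumes f: "f \<in> borel_measurable M" and fin: "\<And>t. 0 < t \<Longrightarrow> dist_inv (dist_fn M f) t < \<infinity>"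
  shows "(\<lambda>t. enn2real (dist_inv (dist_fn M f) t)) \<in> borel_measurable M0"
proof (subst borel_measurable_iff_le, intro allI)
  fix a :: real
  show "{t \<in> space M0. enn2real (dist_inv (dist_fn M f) t) \<le> a} \<in> sets M0"
  proof (cases "0 \<le> a")
    case True
    have "{t \<in> space M0. enn2real (dist_inv (dist_fn M f) t) \<le> a}
      = {t \<in> space M0. dist_fn M f a \<le> ennreal t}"
    proof (rule Collect_cong, rule conj_cong[OF refl])
      fix t assume "t \<in> space M0"
      then have "dist_inv (dist_fn M f) t < \<infinity>" using fin by simp
      then have "enn2real (dist_inv (dist_fn M f) t) \<le> a \<longleftrightarrow> dist_inv (dist_fn M f) t \<le> ennreal a"
        using True by (metis ennreal_enn2real ennreal_le_iff enn2real_nonneg infinity_ennreal_def)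
      then show "enn2real (dist_inv (dist_fn M f) t) \<le> a \<longleftrightarrow> dist_fn M f a \<le> ennreal t"
        using dist_inv_dist_fn_le_iff[OF f True] by simp
    qed
    moreover have "{t \<in> space M0. dist_fn M f a \<le> ennreal t} \<in> sets M0"
    proof -
      have "(\<lambda>t::real. ennreal t) \<in> borel_measurable M0"
        by (intro measurable_compose[OF _ measurable_ennreal] measurable_restrict_space1)
          (simp add: measurable_completion)
      then show ?thesis by measurable
    qed
    ultimately show ?thesis by simp
  next
    case False
    then have "{t \<in> space M0. enn2real (dist_inv (dist_fn M f) t) \<le> a} = {}"
      by (auto simp: not_le intro: less_le_trans[OF _ enn2real_nonneg])
    then show ?thesis by (simp only: sets.empty_sets)
  qed
qed

lemma emeasure_M0:
  assumes "A \<subseteq> {0<..}"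
  shows "emeasure M0 A = emeasure lebesgue A"
  using assms by (intro emeasure_restrict_space) auto

text \<open>By the Galois connection the superlevel set at s is the interval from 0 to
  \<open>dist_fn M f s\<close>, whose length is that number.\<close>

lemma dist_fn_dist_inv:
  assumes f: "f \<in> borel_measurable M" and fin: "\<And>t. 0 < t \<Longrightarrow> dist_inv (dist_fn M f) t < \<infinity>"
    and s: "0 \<le> s"
  shows "dist_fn M0 (\<lambda>t. enn2real (dist_inv (dist_fn M f) t)) s = dist_fn M f s"
proof -
  let ?r = "dist_inv (dist_fn M f)"
  have "{t \<in> space M0. s < \<bar>enn2real (?r t)\<bar>} = {t \<in> {0<..}. ennreal t < dist_fn M f s}"
  proof (simp, rule Collect_cong, rule conj_cong[OF refl])
    fix t :: real assume "0 < t"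
    then have "?r t < \<infinity>" using fin by simp
    then have "enn2real (?r t) \<le> s \<longleftrightarrow> ?r t \<le> ennreal s"
      using s by (metis ennreal_enn2real ennreal_le_iff enn2real_nonneg infinity_ennreal_def)
    then show "s < enn2real (?r t) \<longleftrightarrow> ennreal t < dist_fn M f s"
      using dist_inv_dist_fn_le_iff[OF f s, of t] by (simp add: not_le[symmetric])
  qed
  also have "emeasure M0 \<dots> = dist_fn M f s"
  proof (cases "dist_fn M f s")
    case (real r)
    then have "{t \<in> {0<..}. ennreal t < dist_fn M f s} = {0<..<r}"
      by (auto simp: ennreal_less_iff)
    moreover have "emeasure M0 {0<..<r} = ennreal r"
      using real by (subst emeasure_M0) auto
    ultimately show ?thesis using real by simp
  next
    case top
    then have "{t \<in> {0<..}. ennreal t < dist_fn M f s} = {0<..}"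
      by auto
    moreover have "emeasure lebesgue {0::real<..} = \<infinity>"
    proof (rule ccontr)
      assume ne: "emeasure lebesgue {0::real<..} \<noteq> \<infinity>"
      then obtain r where r: "0 \<le> r" "emeasure lebesgue {0::real<..} = ennreal r"
        by (cases "emeasure lebesgue {0::real<..}") auto
      have "emeasure lebesgue {0<..<r+1} \<le> emeasure lebesgue {0::real<..}"
        by (intro emeasure_mono) auto
      then show False using r by (simp add: ennreal_le_iff)
    qed
    ultimately show ?thesis using top emeasure_M0[of "{0<..}"] by simp
  qed
  finally show ?thesis by (simp only: dist_fn_def)
qed

section \<open>Norm axioms and comparison of norms through distribution functions\<close>

lemma ri_bfs_cong:
  assumes "is_ri_bfs N" "f \<in> borel_measurable M0" "g \<in> borel_measurable M0"
    and "\<And>s. 0 \<le> s \<Longrightarrow> dist_fn M0 f s = dist_fn M0 g s"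
  shows "N f = N g"
  using assms unfolding is_ri_bfs_def distr0_eq_dist_fn by blast

lemma bfs_mono:
  assumes "is_ri_bfs N" "f \<in> borel_measurable M0" "g \<in> borel_measurable M0"
    and "AE x in M0. \<bar>f x\<bar> \<le> \<bar>g x\<bar>"
  shows "N f \<le> N g"
  using assms unfolding is_ri_bfs_def is_bfs_def by blast

lemma bfs_cmult:
  assumes "is_ri_bfs N" "f \<in> borel_measurable M0"
  shows "N (\<lambda>x. c * f x) = ennreal \<bar>c\<bar> * N f"
  using assms unfolding is_ri_bfs_def is_bfs_def by blast

lemma bfs_add:
  assumes "is_ri_bfs N" "f \<in> borel_measurable M0" "g \<in> borel_measurable M0"
  shows "N (\<lambda>x. f x + g x) \<le> N f + N g"
  using assms unfolding is_ri_bfs_def is_bfs_def by blast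

lemma bfs_zero:
  assumes "is_ri_bfs N" shows "N (\<lambda>x. 0) = 0"
proof -
  have "\<forall>f. f \<in> borel_measurable M0 \<longrightarrow> (N f = 0 \<longleftrightarrow> (AE x in M0. f x = 0))"
    using assms unfolding is_ri_bfs_def is_bfs_def by blast
  then show ?thesis by simp
qed

lemma bfs_Fatou:
  assumes "is_ri_bfs N" "\<And>n. fs n \<in> borel_measurable M0" "f \<in> borel_measurable M0"
    and "AE x in M0. (\<forall>n. 0 \<le> fs n x \<and> fs n x \<le> fs (Suc n) x) \<and> (\<lambda>n. fs n x) \<longlonglongrightarrow> f x"
  shows "N f = (SUP n. N (fs n))"
  using assms unfolding is_ri_bfs_def is_bfs_def by blast

lemma bfs_sum:
  assumes N: "is_ri_bfs N" and "finite J" "\<And>j. j \<in> J \<Longrightarrow> f j \<in> borel_measurable M0"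
  shows "N (\<lambda>x. \<Sum>j\<in>J. f j x) \<le> (\<Sum>j\<in>J. N (f j))"
  using assms(2,3)
proof (induction J rule: finite_induct)
  case empty
  then show ?case using bfs_zero[OF N] by simp
next
  case (insert j J)
  have "N (\<lambda>x. f j x + (\<Sum>j\<in>J. f j x)) \<le> N (f j) + N (\<lambda>x. \<Sum>j\<in>J. f j x)"
    using insert by (intro bfs_add[OF N]) auto
  also have "\<dots> \<le> N (f j) + (\<Sum>j\<in>J. N (f j))"
    using insert by (intro add_left_mono) auto
  finally show ?case using insert by simp
qed

text \<open>G and its rearrangement are equimeasurable. This turns norms of rearrangements, which
  define \<open>rnorm\<close>, into norms of functions on the half-line.\<close>

lemma ri_bfs_dist_inv:
  assumes N: "is_ri_bfs N" and G: "G \<in> borel_measurable M0"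
    and fin: "\<And>t. 0 < t \<Longrightarrow> dist_inv (dist_fn M0 G) t < \<infinity>"
  shows "N (\<lambda>t. enn2real (dist_inv (dist_fn M0 G) t)) = N G"
  using borel_measurable_dist_inv[OF G fin] G dist_fn_dist_inv[OF G fin] by (intro ri_bfs_cong[OF N])

text \<open>The bound S excludes the case that the rearrangement of G is infinite somewhere, where its real value is junk.\<close>

lemma rnorm_le_of_dist_fn:
  fixes v :: "'a::euclidean_space \<Rightarrow> real"
  assumes N: "is_ri_bfs N" and v: "v \<in> borel_measurable lebesgue" and G: "G \<in> borel_measurable M0"
    and S: "0 \<le> S" "dist_fn M0 G S = 0"
    and le: "\<And>s. 0 \<le> s \<Longrightarrow> dist_fn lebesgue v s \<le> dist_fn M0 G s"
  shows "rnorm N v \<le> N G"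
proof -
  have finG: "dist_inv (dist_fn M0 G) t < \<infinity>" for t
  proof -
    have "dist_inv (dist_fn M0 G) t \<le> ennreal S"
      using dist_inv_dist_fn_le_iff[OF G S(1)] S by simp
    then show ?thesis using ennreal_less_top le_less_trans by (metis infinity_ennreal_def)
  qed
  have ord: "dist_inv (dist_fn lebesgue v) t \<le> dist_inv (dist_fn M0 G) t" for t
    using le by (rule dist_inv_mono)
  have finv: "dist_inv (dist_fn lebesgue v) t < \<infinity>" for t
    using ord finG le_less_trans by blast
  have "rnorm N v = N (\<lambda>t. enn2real (dist_inv (dist_fn lebesgue v) t))"
    unfolding rnorm_def rearr_eq_dist_inv distr_eq_dist_fn using finv by simp
  also have "\<dots> \<le> N (\<lambda>t. enn2real (dist_inv (dist_fn M0 G) t))"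
  proof (rule bfs_mono[OF N])
    show "AE x in M0. \<bar>enn2real (dist_inv (dist_fn lebesgue v) x)\<bar> \<le> \<bar>enn2real (dist_inv (dist_fn M0 G) x)\<bar>"
      using ord finG by (intro AE_I2) (simp add: enn2real_mono)
  qed (use borel_measurable_dist_inv v G finv finG in auto)
  also have "\<dots> = N G"
    by (rule ri_bfs_dist_inv[OF N G finG])
  finally show ?thesis .
qed

text \<open>If the rearrangement of v is infinite somewhere, \<open>rnorm\<close> is infinite by
  convention. Otherwise that of G is finite too, and the order of the distribution functions passes
  to the rearrangements.\<close>

lemma rnorm_ge_of_dist_fn:
  fixes v :: "'a::euclidean_space \<Rightarrow> real"
  assumes N: "is_ri_bfs N" and v: "v \<in> borel_measurable lebesgue" and G: "G \<in> borel_measurable M0"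
    and le: "\<And>s. 0 \<le> s \<Longrightarrow> dist_fn M0 G s \<le> dist_fn lebesgue v s"
  shows "N G \<le> rnorm N v"
proof (cases "\<forall>t>0. dist_inv (dist_fn lebesgue v) t < \<infinity>")
  case True
  have ord: "dist_inv (dist_fn M0 G) t \<le> dist_inv (dist_fn lebesgue v) t" for t
    using le by (rule dist_inv_mono)
  have finG: "dist_inv (dist_fn M0 G) t < \<infinity>" if "0 < t" for t
    using ord True that le_less_trans by blast
  have "N G = N (\<lambda>t. enn2real (dist_inv (dist_fn M0 G) t))"
    by (rule ri_bfs_dist_inv[OF N G finG, symmetric])
  also have "\<dots> \<le> N (\<lambda>t. enn2real (dist_inv (dist_fn lebesgue v) t))"
  proof (rule bfs_mono[OF N])
    show "AE x in M0. \<bar>enn2real (dist_inv (dist_fn M0 G) x)\<bar> \<le> \<bar>enn2real (dist_inv (dist_fn lebesgue v) x)\<bar>"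
      using ord True by (intro AE_I2) (simp add: enn2real_mono)
  qed (use borel_measurable_dist_inv v G True finG in auto)
  also have "\<dots> = rnorm N v"
    unfolding rnorm_def rearr_eq_dist_inv distr_eq_dist_fn using True by simp
  finally show ?thesis .
next
  case False
  then show ?thesis unfolding rnorm_def rearr_eq_dist_inv distr_eq_dist_fn by auto
qed

section \<open>Step functions\<close>

definition step_fn :: "'k set \<Rightarrow> ('k \<Rightarrow> real) \<Rightarrow> ('k \<Rightarrow> 'a set) \<Rightarrow> 'a \<Rightarrow> real" where
  "step_fn I c E x = (\<Sum>k\<in>I. c k * indicat_real (E k) x)"

text \<open>The measures are prescribed independently of the space: packings with equal m on the
  half-line and in R^d give equimeasurable step functions.\<close>

definition packing :: "'a measure \<Rightarrow> 'k set \<Rightarrow> ('k \<Rightarrow> real) \<Rightarrow> ('k \<Rightarrow> 'a set) \<Rightarrow> bool" where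
  "packing M I m E \<longleftrightarrow> disjoint_family_on E I \<and>
     (\<forall>k\<in>I. E k \<in> sets M \<and> emeasure M (E k) = ennreal (m k))"

lemma step_fn_in:
  assumes "finite I" "disjoint_family_on E I" "k \<in> I" "x \<in> E k"
  shows "step_fn I c E x = c k"
proof -
  have "c l * indicat_real (E l) x = (if l = k then c k else 0)" if "l \<in> I" for l
    using assms that by (auto simp: disjoint_family_on_def indicator_def)
  then have "step_fn I c E x = (\<Sum>l\<in>I. if l = k then c k else 0)"
    unfolding step_fn_def by (intro sum.cong) auto
  then show ?thesis using assms by simp
qed

lemma step_fn_out:
  assumes "\<And>k. k \<in> I \<Longrightarrow> x \<notin> E k"
  shows "step_fn I c E x = 0"
  unfolding step_fn_def using assms by (intro sum.neutral) (auto simp: indicator_def)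

lemma borel_measurable_step_fn:
  assumes "packing M I m E"
  shows "step_fn I c E \<in> borel_measurable M"
  using assms unfolding step_fn_def[abs_def] packing_def by (intro borel_measurable_sum) auto

lemma dist_fn_step_fn:
  assumes I: "finite I" and E: "packing M I m E" and s: "0 \<le> s"
  shows "dist_fn M (step_fn I c E) s = (\<Sum>k\<in>{k \<in> I. s < \<bar>c k\<bar>}. ennreal (m k))"
proof -
  have dis: "disjoint_family_on E I" and sets: "\<And>k. k \<in> I \<Longrightarrow> E k \<in> sets M"
    and em: "\<And>k. k \<in> I \<Longrightarrow> emeasure M (E k) = ennreal (m k)"
    using E by (auto simp: packing_def)
  have "{x \<in> space M. s < \<bar>step_fn I c E x\<bar>} = (\<Union>k\<in>{k \<in> I. s < \<bar>c k\<bar>}. E k)"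
  proof (intro equalityI subsetI)
    fix x assume x: "x \<in> {x \<in> space M. s < \<bar>step_fn I c E x\<bar>}"
    then have "step_fn I c E x \<noteq> 0" using s by auto
    then obtain k where "k \<in> I" "x \<in> E k" using step_fn_out by metis
    then show "x \<in> (\<Union>k\<in>{k \<in> I. s < \<bar>c k\<bar>}. E k)"
      using x step_fn_in[OF I dis] by auto
  next
    fix x assume "x \<in> (\<Union>k\<in>{k \<in> I. s < \<bar>c k\<bar>}. E k)"
    then show "x \<in> {x \<in> space M. s < \<bar>step_fn I c E x\<bar>}"
      using step_fn_in[OF I dis] sets sets.sets_into_space by fastforce
  qed
  then have "dist_fn M (step_fn I c E) s = emeasure M (\<Union>k\<in>{k \<in> I. s < \<bar>c k\<bar>}. E k)"
    by (simp add: dist_fn_def)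
  also have "\<dots> = (\<Sum>k\<in>{k \<in> I. s < \<bar>c k\<bar>}. emeasure M (E k))"
    using I sets dis by (intro sum_emeasure[symmetric]) (auto simp: disjoint_family_on_def)
  finally show ?thesis using em by simp
qed

text \<open>The intervals are laid end to end; being half-open, neighbours may touch.\<close>

lemma intervals_disjoint_ex:
  fixes m :: "'k \<Rightarrow> real"
  assumes "finite I" "\<forall>k\<in>I. 0 \<le> m k"
  shows "\<exists>p. (\<forall>k\<in>I. 0 \<le> p k) \<and> disjoint_family_on (\<lambda>k. {p k<..p k + m k}) I"
proof -
  \<comment> \<open>R, a right bound of the occupied part, is where the next interval
    begins.\<close>
  have "\<exists>p R. 0 \<le> R \<and> (\<forall>k\<in>I. 0 \<le> p k \<and> p k + m k \<le> R) \<and>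
      disjoint_family_on (\<lambda>k. {p k<..p k + m k}) I"
    using assms
  proof (induction I rule: finite_induct)
    case empty
    then show ?case by (auto simp: disjoint_family_on_def)
  next
    case (insert i I)
    then obtain p R where p: "0 \<le> R" "\<forall>k\<in>I. 0 \<le> p k \<and> p k + m k \<le> R"
      "disjoint_family_on (\<lambda>k. {p k<..p k + m k}) I" by auto
    have mi: "0 \<le> m i" using insert by auto
    let ?q = "p(i := R)"
    have q: "?q k = p k" if "k \<in> I" for k using that insert by auto
    have "disjoint_family_on (\<lambda>k. {?q k<..?q k + m k}) (insert i I)"
      unfolding disjoint_family_on_insert[OF \<open>i \<notin> I\<close>]
    proof
      show "{?q i<..?q i + m i} \<inter> (\<Union>k\<in>I. {?q k<..?q k + m k}) = {}"
        using p(2) q by fastforce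
      show "disjoint_family_on (\<lambda>k. {?q k<..?q k + m k}) I"
        using p(3) q by (simp add: disjoint_family_on_def)
    qed
    moreover have "\<forall>k\<in>insert i I. 0 \<le> ?q k \<and> ?q k + m k \<le> R + m i"
      using p(1,2) mi by force
    ultimately show ?case using p(1) mi by (intro exI[of _ ?q] exI[of _ "R + m i"]) auto
  qed
  then show ?thesis by blast
qed

text \<open>The positions serve on the half-line for \<open>slot\<close> and again in R^d, where
  they place the cells along one axis.\<close>

definition place :: "'k set \<Rightarrow> ('k \<Rightarrow> real) \<Rightarrow> 'k \<Rightarrow> real" where
  "place I m = (SOME p. (\<forall>k\<in>I. 0 \<le> p k) \<and> disjoint_family_on (\<lambda>k. {p k<..p k + m k}) I)"

definition slot :: "'k set \<Rightarrow> ('k \<Rightarrow> real) \<Rightarrow> 'k \<Rightarrow> real set" where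
  "slot I m k = {place I m k<..place I m k + m k}"

lemma
  assumes "finite I" "\<forall>k\<in>I. 0 \<le> m k"
  shows place_nonneg: "k \<in> I \<Longrightarrow> 0 \<le> place I m k"
    and disjoint_slot: "disjoint_family_on (slot I m) I"
proof -
  have "(\<forall>k\<in>I. 0 \<le> place I m k) \<and> disjoint_family_on (\<lambda>k. {place I m k<..place I m k + m k}) I"
    unfolding place_def by (rule someI_ex[OF intervals_disjoint_ex[OF assms]])
  then show "k \<in> I \<Longrightarrow> 0 \<le> place I m k" "disjoint_family_on (slot I m) I"
    by (auto simp: slot_def[abs_def])
qed

lemma packing_slot:
  assumes "finite I" "\<forall>k\<in>I. 0 \<le> m k"
  shows "packing M0 I m (slot I m)"
proof -
  have "slot I m k \<in> sets M0 \<and> emeasure M0 (slot I m k) = ennreal (m k)" if k: "k \<in> I" for k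
  proof -
    have sub: "slot I m k \<subseteq> {0<..}" using place_nonneg[OF assms k] by (auto simp: slot_def)
    have "slot I m k \<in> sets M0"
      using sub by (subst sets_restrict_space_iff) (auto simp: slot_def)
    moreover have "emeasure M0 (slot I m k) = ennreal (m k)"
      using assms(2) k by (subst emeasure_M0[OF sub]) (simp add: slot_def)
    ultimately show ?thesis ..
  qed
  then show ?thesis using disjoint_slot[OF assms] by (auto simp: packing_def)
qed

text \<open>By rearrangement invariance the norm depends only on the values c k and the measures m k of the sets
on which they are taken (\<open>step_norm_eq\<close>).\<close>

definition step_norm :: "((real \<Rightarrow> real) \<Rightarrow> ennreal) \<Rightarrow> 'k set \<Rightarrow> ('k \<Rightarrow> real) \<Rightarrow> ('k \<Rightarrow> real) \<Rightarrow> ennreal"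
  where "step_norm N I c m = N (step_fn I c (slot I m))"

lemma step_norm_eq:
  assumes N: "is_ri_bfs N" and I: "finite I" "\<forall>k\<in>I. 0 \<le> m k" and E: "packing M0 I m E"
  shows "N (step_fn I c E) = step_norm N I c m"
  unfolding step_norm_def
  by (rule ri_bfs_cong[OF N])
    (use borel_measurable_step_fn[OF E] borel_measurable_step_fn[OF packing_slot[OF I]]
      dist_fn_step_fn[OF I(1) E] dist_fn_step_fn[OF I(1) packing_slot[OF I]] in auto)

text \<open>The pieces of a step keep its value and their measures add up to m k, so the
  distribution function is unchanged.\<close>

lemma step_norm_refine:
  assumes N: "is_ri_bfs N" and I: "finite I" "\<forall>k\<in>I. 0 \<le> m k"
    and L: "\<forall>k\<in>I. 0 < L k"
  shows "step_norm N (SIGMA k:I. {..<L k}) (\<lambda>x. c (fst x)) (\<lambda>x. m (fst x) / real (L (fst x)))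
    = step_norm N I c m"
proof -
  let ?I = "SIGMA k:I. {..<L k}" and ?m = "\<lambda>x. m (fst x) / real (L (fst x))"
  have I': "finite ?I" "\<forall>x\<in>?I. 0 \<le> ?m x" using I by auto
  show ?thesis unfolding step_norm_def
  proof (rule ri_bfs_cong[OF N])
    fix s :: real assume s: "0 \<le> s"
    have "{x \<in> ?I. s < \<bar>c (fst x)\<bar>} = (SIGMA k:{k \<in> I. s < \<bar>c k\<bar>}. {..<L k})" by auto
    then have "(\<Sum>x\<in>{x \<in> ?I. s < \<bar>c (fst x)\<bar>}. ennreal (?m x))
       = (\<Sum>k\<in>{k \<in> I. s < \<bar>c k\<bar>}. \<Sum>j<L k. ennreal (m k / real (L k)))"
      using I(1) by (subst sum.Sigma) (simp_all add: case_prod_beta')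
    also have "\<dots> = (\<Sum>k\<in>{k \<in> I. s < \<bar>c k\<bar>}. ennreal (m k))"
    proof (intro sum.cong refl)
      fix k assume k: "k \<in> {k \<in> I. s < \<bar>c k\<bar>}"
      have "(\<Sum>j<L k. ennreal (m k / real (L k))) = ennreal (\<Sum>j<L k. m k / real (L k))"
        using I(2) k by (intro sum_ennreal) auto
      then show "(\<Sum>j<L k. ennreal (m k / real (L k))) = ennreal (m k)"
        using L I(2) k by auto
    qed
    finally show "dist_fn M0 (step_fn ?I (\<lambda>x. c (fst x)) (slot ?I ?m)) s
      = dist_fn M0 (step_fn I c (slot I m)) s"
      using dist_fn_step_fn[OF I'(1) packing_slot[OF I'] s] dist_fn_step_fn[OF I(1) packing_slot[OF I] s]
      by metis
  qed (rule borel_measurable_step_fn[OF packing_slot[OF I']] borel_measurable_step_fn[OF packing_slot[OF I]])+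
qed

text \<open>Subdividing each set into L equal parts writes a step function as a sum of L equimeasurable ones.\<close>

lemma step_norm_shrink:
  assumes N: "is_ri_bfs N" and I: "finite I" "\<forall>k\<in>I. 0 \<le> m k" and L: "0 < L"
  shows "step_norm N I c m \<le> of_nat L * step_norm N I c (\<lambda>k. m k / real L)"
proof -
  let ?I = "SIGMA k:I. {..<L}" and ?m = "\<lambda>x. m (fst x) / real L"
  let ?E = "slot ?I ?m"
  have I': "finite ?I" "\<forall>x\<in>?I. 0 \<le> ?m x" using I by auto
  have pk: "packing M0 ?I ?m ?E" by (rule packing_slot[OF I'])
  \<comment> \<open>One piece of every step, with j fixed: these carry the original values on
    measures divided by L.\<close>
  have pkj: "packing M0 I (\<lambda>k. m k / real L) (\<lambda>k. ?E (k, j))" if "j < L" for j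
    using pk that by (auto simp: packing_def disjoint_family_on_def)
  have "step_norm N I c m = N (step_fn ?I (\<lambda>x. c (fst x)) ?E)"
    using step_norm_refine[OF N I, where L="\<lambda>_. L" and c=c] L by (simp add: step_norm_def)
  also have "step_fn ?I (\<lambda>x. c (fst x)) ?E = (\<lambda>x. \<Sum>j<L. step_fn I c (\<lambda>k. ?E (k, j)) x)"
  proof
    fix x
    have "step_fn ?I (\<lambda>x. c (fst x)) ?E x = (\<Sum>k\<in>I. \<Sum>j<L. c k * indicat_real (?E (k, j)) x)"
      unfolding step_fn_def using I(1) by (subst sum.Sigma) (auto simp: case_prod_beta)
    then show "step_fn ?I (\<lambda>x. c (fst x)) ?E x = (\<Sum>j<L. step_fn I c (\<lambda>k. ?E (k, j)) x)"
      unfolding step_fn_def by (subst sum.swap) simp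
  qed
  also have "N \<dots> \<le> (\<Sum>j<L. N (step_fn I c (\<lambda>k. ?E (k, j))))"
    using pkj by (intro bfs_sum[OF N]) (auto intro: borel_measurable_step_fn)
  also have "\<dots> = (\<Sum>j<L. step_norm N I c (\<lambda>k. m k / real L))"
    using pkj I by (intro sum.cong refl step_norm_eq[OF N]) auto
  finally show ?thesis by simp
qed

lemma step_norm_cmult:
  assumes N: "is_ri_bfs N" and I: "finite I" "\<forall>k\<in>I. 0 \<le> m k"
  shows "step_norm N I (\<lambda>k. r * c k) m = ennreal \<bar>r\<bar> * step_norm N I c m"
proof -
  have "step_fn I (\<lambda>k. r * c k) (slot I m) = (\<lambda>x. r * step_fn I c (slot I m) x)"
    by (simp add: fun_eq_iff step_fn_def sum_distrib_left mult.assoc)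
  then show ?thesis unfolding step_norm_def
    using bfs_cmult[OF N borel_measurable_step_fn[OF packing_slot[OF I]]] by simp
qed

lemma rnorm_le_step_norm:
  fixes v :: "'a::euclidean_space \<Rightarrow> real"
  assumes N: "is_ri_bfs N" and I: "finite I" "\<forall>k\<in>I. 0 \<le> m k"
    and v: "v \<in> borel_measurable lebesgue" and E: "packing lebesgue I m E"
    and le: "\<And>x. \<bar>v x\<bar> \<le> \<bar>step_fn I c E x\<bar>"
  shows "rnorm N v \<le> step_norm N I c m"
  unfolding step_norm_def
proof (rule rnorm_le_of_dist_fn[OF N v])
  show "step_fn I c (slot I m) \<in> borel_measurable M0"
    by (rule borel_measurable_step_fn[OF packing_slot[OF I]])
  \<comment> \<open>The level S above which the step function takes no values: no single value
    exceeds the sum.\<close>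
  show "0 \<le> (\<Sum>k\<in>I. \<bar>c k\<bar>)" by (simp add: sum_nonneg)
  have "{k \<in> I. (\<Sum>k\<in>I. \<bar>c k\<bar>) < \<bar>c k\<bar>} = {}"
  proof -
    have "\<bar>c k\<bar> \<le> (\<Sum>k\<in>I. \<bar>c k\<bar>)" if "k \<in> I" for k
      using that I(1) by (intro member_le_sum) auto
    then show ?thesis by (auto simp: not_less)
  qed
  then show "dist_fn M0 (step_fn I c (slot I m)) (\<Sum>k\<in>I. \<bar>c k\<bar>) = 0"
    by (subst dist_fn_step_fn[OF I(1) packing_slot[OF I]]) (auto intro: sum_nonneg simp only: sum.empty)
  fix s :: real assume s: "0 \<le> s"
  have "dist_fn lebesgue v s \<le> dist_fn lebesgue (step_fn I c E) s"
    using le by (intro dist_fn_mono v borel_measurable_step_fn[OF E]) auto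
  then show "dist_fn lebesgue v s \<le> dist_fn M0 (step_fn I c (slot I m)) s"
    using dist_fn_step_fn[OF I(1) packing_slot[OF I] s] dist_fn_step_fn[OF I(1) E s] by metis
qed

lemma rnorm_ge_step_norm:
  fixes v :: "'a::euclidean_space \<Rightarrow> real"
  assumes N: "is_ri_bfs N" and I: "finite I" "\<forall>k\<in>I. 0 \<le> m k"
    and v: "v \<in> borel_measurable lebesgue" and E: "packing lebesgue I m E"
    and le: "\<And>x. \<bar>step_fn I c E x\<bar> \<le> \<bar>v x\<bar>"
  shows "step_norm N I c m \<le> rnorm N v"
  unfolding step_norm_def
proof (rule rnorm_ge_of_dist_fn[OF N v])
  show "step_fn I c (slot I m) \<in> borel_measurable M0"
    by (rule borel_measurable_step_fn[OF packing_slot[OF I]])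
  fix s :: real assume s: "0 \<le> s"
  have "dist_fn lebesgue (step_fn I c E) s \<le> dist_fn lebesgue v s"
    using le by (intro dist_fn_mono v borel_measurable_step_fn[OF E]) auto
  then show "dist_fn M0 (step_fn I c (slot I m)) s \<le> dist_fn lebesgue v s"
    using dist_fn_step_fn[OF I(1) packing_slot[OF I] s] dist_fn_step_fn[OF I(1) E s] by metis
qed

section \<open>Weak derivatives of smooth functions\<close>

lemma integral_translate_lborel:
  fixes F :: "'a::euclidean_space \<Rightarrow> real"
  assumes F: "F \<in> borel_measurable borel"
  shows "(\<integral>x. F (a + x) \<partial>lborel) = (\<integral>x. F x \<partial>lborel)"
proof -
  have "(\<integral>x. F x \<partial>lborel) = (\<integral>x. F x \<partial>Measure_Space.distr lborel borel ((+) a))"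
    by (simp add: lborel_distr_plus)
  also have "\<dots> = (\<integral>x. F (a + x) \<partial>lborel)"
    using F by (subst integral_distr) auto
  finally show ?thesis by simp
qed

lemma integrable_compact_support:
  fixes F :: "'a::euclidean_space \<Rightarrow> real"
  assumes F: "continuous_on UNIV F" and K: "compact K" "\<And>x. x \<notin> K \<Longrightarrow> F x = 0"
  shows "integrable lborel F"
proof -
  have "integrable lborel (\<lambda>x. indicator K x *\<^sub>R F x)"
    using K F by (intro borel_integrable_compact) (auto intro: continuous_on_subset)
  also have "(\<lambda>x. indicator K x *\<^sub>R F x) = F"
    using K(2) by (auto simp: indicator_def fun_eq_iff)
  finally show ?thesis .
qed

text \<open>By translation invariance all difference quotients of F have integral 0; let the step size tend to 0.\<close>

lemma integral_directional_deriv_0: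
  fixes F G :: "'a::euclidean_space \<Rightarrow> real"
  assumes F: "continuous_on UNIV F" and G: "continuous_on UNIV G"
    and K: "compact K" "\<And>x. x \<notin> K \<Longrightarrow> F x = 0"
    and deriv: "\<And>x. ((\<lambda>t. F (x + t *\<^sub>R e)) has_field_derivative G x) (at 0)"
  shows "(\<integral>x. G x \<partial>lborel) = 0"
proof -
  have dF: "((\<lambda>t. F (x + t *\<^sub>R e)) has_field_derivative G (x + t *\<^sub>R e)) (at t)" for x t
  proof -
    have "((\<lambda>s. F (x + (s + t) *\<^sub>R e)) has_field_derivative G (x + t *\<^sub>R e)) (at 0)"
      using deriv[of "x + t *\<^sub>R e"] by (simp add: algebra_simps)
    then show ?thesis
      using DERIV_shift[of "\<lambda>s. F (x + s *\<^sub>R e)" "G (x + t *\<^sub>R e)" 0 t] by simp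
  qed
  obtain R where R: "0 < R" "K \<subseteq> ball 0 R" using compact_imp_bounded[OF K(1)] bounded_subset_ballD by blast
  \<comment> \<open>Large enough that off S neither end of a difference quotient with step at most 1
    meets the support of F.\<close>
  define S where "S = cball (0::'a) (R + norm e)"
  have F0: "F (x + t *\<^sub>R e) = 0" if "x \<notin> S" "0 \<le> t" "t \<le> 1" for x t
  proof (rule K(2))
    have "norm x \<le> norm (x + t *\<^sub>R e) + norm (t *\<^sub>R e)"
      using norm_triangle_ineq4[of "x + t *\<^sub>R e" "t *\<^sub>R e"] by simp
    moreover have "norm (t *\<^sub>R e) \<le> norm e" using that by (simp add: mult_left_le_one_le)
    ultimately have "R < norm (x + t *\<^sub>R e)" using that by (simp add: S_def)
    then show "x + t *\<^sub>R e \<notin> K" using R(2) by auto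
  qed
  \<comment> \<open>This ball contains the mean value points x + z e with x in S and z <= 1, at
    which G equals the difference quotients.\<close>
  have "bounded (G ` cball 0 (R + 2 * norm e))"
    using G by (intro compact_imp_bounded compact_continuous_image) (auto intro: continuous_on_subset)
  then obtain M where "\<forall>x\<in>cball 0 (R + 2 * norm e). \<bar>G x\<bar> \<le> M"
    unfolding bounded_iff by auto
  then have M: "\<And>x. norm x \<le> R + 2 * norm e \<Longrightarrow> \<bar>G x\<bar> \<le> M"
    by auto
  define h where "h n = 1 / real (Suc n)" for n
  have h: "0 < h n" "h n \<le> 1" for n by (auto simp: h_def field_simps)
  have h0: "h \<longlonglongrightarrow> 0" unfolding h_def by (rule LIMSEQ_Suc[OF lim_1_over_n])
  define q where "q n x = (F (h n *\<^sub>R e + x) - F x) / h n" for n x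
  have Fm: "F \<in> borel_measurable borel" using F by (rule borel_measurable_continuous_onI)
  have contF: "continuous_on UNIV (\<lambda>x. F (a + x))" for a
    by (intro continuous_on_compose2[OF F] continuous_intros) auto
  have Fa: "integrable lborel (\<lambda>x. F (h n *\<^sub>R e + x))" for n
  proof (rule integrable_compact_support[OF contF, of S])
    show "F (h n *\<^sub>R e + x) = 0" if "x \<notin> S" for x
      using F0[OF that, of "h n"] h[of n] by (simp add: add.commute less_imp_le)
  qed (simp add: S_def)
  have Fi: "integrable lborel F" by (rule integrable_compact_support[OF F K])
  have q0: "(\<integral>x. q n x \<partial>lborel) = 0" for n
    unfolding q_def using Fa Fi integral_translate_lborel[OF Fm] by simp
  have bound: "norm (q n x) \<le> M * indicat_real S x" for n x
  proof (cases "x \<in> S")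
    case True
    obtain z where z: "0 < z" "z < h n"
      "F (x + h n *\<^sub>R e) - F (x + 0 *\<^sub>R e) = (h n - 0) * G (x + z *\<^sub>R e)"
      using MVT2[OF h(1), of n "\<lambda>t. F (x + t *\<^sub>R e)" "\<lambda>t. G (x + t *\<^sub>R e)"] dF by blast
    have "q n x = G (x + z *\<^sub>R e)" using z h(1)[of n] by (simp add: q_def add.commute)
    moreover have "norm (x + z *\<^sub>R e) \<le> R + 2 * norm e"
    proof -
      have "norm (x + z *\<^sub>R e) \<le> norm x + norm (z *\<^sub>R e)" by (rule norm_triangle_ineq)
      moreover have "norm (z *\<^sub>R e) \<le> norm e" using z h(2)[of n] by (simp add: mult_left_le_one_le)
      ultimately show ?thesis using True by (simp add: S_def)
    qed
    ultimately show ?thesis using M True by simp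
  next
    case False
    then have "q n x = 0"
      using F0[OF False, of "h n"] F0[OF False, of 0] h[of n] by (simp add: q_def add.commute less_imp_le)
    then show ?thesis using False by simp
  qed
  have lim: "(\<lambda>n. q n x) \<longlonglongrightarrow> G x" for x
  proof -
    have "((\<lambda>t. (F (x + t *\<^sub>R e) - F x) / t) \<longlongrightarrow> G x) (at 0)"
      using deriv[of x] by (simp add: has_field_derivative_iff)
    moreover have "filterlim h (at 0) sequentially"
      using h0 h(1) by (intro filterlim_atI always_eventually allI) (auto simp: less_imp_neq[symmetric])
    ultimately have "(\<lambda>n. (F (x + h n *\<^sub>R e) - F x) / h n) \<longlonglongrightarrow> G x"
      by (rule filterlim_compose)
    then show ?thesis by (simp add: q_def add.commute)
  qed
  have "(\<lambda>n. \<integral>x. q n x \<partial>lborel) \<longlonglongrightarrow> (\<integral>x. G x \<partial>lborel)"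
  proof (rule integral_dominated_convergence[where w="\<lambda>x. M * indicat_real S x"])
    show "integrable lborel (\<lambda>x. M * indicat_real S x)"
      unfolding S_def by (intro integrable_mult_right integrable_real_indicator)
        (auto simp: emeasure_lborel_cball_finite[simplified])
    show "G \<in> borel_measurable lborel" using G by (simp add: borel_measurable_continuous_onI)
    show "q n \<in> borel_measurable lborel" for n
      unfolding q_def using Fa Fi by (intro borel_measurable_divide borel_measurable_diff) auto
  qed (use lim bound in auto)
  then show ?thesis by (simp add: q0 LIMSEQ_const_iff)
qed

lemma test_fn_partial:
  assumes "test_fn \<phi>"
  shows "((\<lambda>t. iter_partial is \<phi> (x + t *\<^sub>R axis i 1)) has_field_derivative iter_partial (i # is) \<phi> x) (at 0)"
  using assms by (auto simp: test_fn_def partial_def field_differentiable_derivI)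

text \<open>The complement of the closed support is open, so the previous iterated derivative
  vanishes on a short segment through x, and so does its derivative along that segment.\<close>

lemma iter_partial_support:
  assumes \<phi>: "test_fn \<phi>" and x: "x \<notin> closure {x. \<phi> x \<noteq> 0}"
  shows "iter_partial is \<phi> x = 0"
  using x
proof (induction "is" arbitrary: x)
  case Nil
  then show ?case using closure_subset[of "{x. \<phi> x \<noteq> 0}"] by auto
next
  case (Cons i "is")
  have "open (- closure {x. \<phi> x \<noteq> 0})" using closed_closure by blast
  then obtain r where r: "r > 0" "ball x r \<subseteq> - closure {x. \<phi> x \<noteq> 0}"
    using Cons.prems by (meson ComplI open_contains_ball)
  have "((\<lambda>t. 0) has_field_derivative iter_partial (i # is) \<phi> x) (at 0)"
  proof (rule has_field_derivative_transform_within[OF test_fn_partial[OF \<phi>] r(1)])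
    fix t :: real assume "dist t 0 < r"
    then have "x + t *\<^sub>R axis i 1 \<in> ball x r" by (simp add: dist_norm)
    then show "iter_partial is \<phi> (x + t *\<^sub>R axis i 1) = 0" using r Cons.IH by blast
  qed simp
  then show ?case by (metis DERIV_const DERIV_unique)
qed

text \<open>By the product rule the two integrands add up to a derivative along axis i of a product,
  to which \<open>integral_directional_deriv_0\<close> applies. The factor from \<phi> provides the
  compact support.\<close>

lemma integration_by_parts_test_fn:
  fixes v w \<phi> :: "real^'n::finite \<Rightarrow> real"
  assumes v: "continuous_on UNIV v" and w: "continuous_on UNIV w"
    and deriv: "\<And>x. ((\<lambda>t. v (x + t *\<^sub>R axis i 1)) has_field_derivative w x) (at 0)"
    and \<phi>: "test_fn \<phi>"
  shows "(\<integral>x. v x * iter_partial (i # is) \<phi> x \<partial>lebesgue)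
    = - (\<integral>x. w x * iter_partial is \<phi> x \<partial>lebesgue)"
proof -
  let ?K = "closure {x. \<phi> x \<noteq> 0}"
  have K: "compact ?K" using \<phi> by (simp add: test_fn_def)
  have c: "continuous_on UNIV (iter_partial js \<phi>)" for js using \<phi> by (simp add: test_fn_def)
  have z: "iter_partial js \<phi> x = 0" if "x \<notin> ?K" for js x by (rule iter_partial_support[OF \<phi> that])
  have 1: "continuous_on UNIV (\<lambda>x. v x * iter_partial (i # is) \<phi> x)"
    "continuous_on UNIV (\<lambda>x. w x * iter_partial is \<phi> x)"
    "continuous_on UNIV (\<lambda>x. v x * iter_partial is \<phi> x)"
    by (intro continuous_on_mult v w c)+
  have int: "integrable lborel (\<lambda>x. v x * iter_partial (i # is) \<phi> x)"
    "integrable lborel (\<lambda>x. w x * iter_partial is \<phi> x)"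
    by (rule integrable_compact_support[OF 1(1) K] integrable_compact_support[OF 1(2) K];
        simp add: z del: iter_partial.simps)+
  have "(\<integral>x. w x * iter_partial is \<phi> x + v x * iter_partial (i # is) \<phi> x \<partial>lborel) = 0"
  proof (rule integral_directional_deriv_0[OF 1(3) continuous_on_add[OF 1(2,1)] K])
    fix x
    show "((\<lambda>t. v (x + t *\<^sub>R axis i 1) * iter_partial is \<phi> (x + t *\<^sub>R axis i 1)) has_field_derivative
       w x * iter_partial is \<phi> x + v x * iter_partial (i # is) \<phi> x) (at 0)"
      using DERIV_mult[OF deriv test_fn_partial[OF \<phi>], of x "is" x i] by (simp add: mult.commute add.commute)
  qed (use z in auto)
  then have "(\<integral>x. v x * iter_partial (i # is) \<phi> x \<partial>lborel) = - (\<integral>x. w x * iter_partial is \<phi> x \<partial>lborel)"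
    using int by (subst (asm) Bochner_Integration.integral_add) auto
  then show ?thesis using 1 by (simp add: integral_completion borel_measurable_continuous_onI del: iter_partial.simps)
qed

lemma loc_int_continuous:
  assumes "continuous_on UNIV u" shows "loc_int u"
  unfolding loc_int_def
proof (intro allI impI)
  fix K :: "(real^'a) set" assume K: "compact K"
  have "integrable lborel (\<lambda>x. indicator K x *\<^sub>R u x)"
    using K assms by (intro borel_integrable_compact) (auto intro: continuous_on_subset)
  then show "set_integrable lebesgue K u"
    unfolding set_integrable_def using integrable_completion by (metis borel_measurable_integrable integrable_completion)
qed

text \<open>Each direction in the list is moved from the test function to D by one integration by
  parts. D is indexed by multi-indices, which makes the order of the directions irrelevant.\<close>

lemma W21loc_with_classical:
  fixes D :: "('n::finite \<Rightarrow> nat) \<Rightarrow> real^'n \<Rightarrow> real"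
  assumes cont: "\<And>\<alpha>. sum \<alpha> UNIV \<le> 2 \<Longrightarrow> continuous_on UNIV (D \<alpha>)"
    and deriv: "\<And>\<alpha> i x. sum \<alpha> UNIV \<le> 1 \<Longrightarrow>
      ((\<lambda>t. D \<alpha> (x + t *\<^sub>R axis i 1)) has_field_derivative D (\<alpha>(i := Suc (\<alpha> i))) x) (at 0)"
  shows "W21loc_with (D (\<lambda>_. 0)) D"
proof -
  have sum_upd: "sum (\<beta>(i := Suc (\<beta> i))) UNIV = Suc (sum \<beta> UNIV)" for \<beta> :: "'n \<Rightarrow> nat" and i
    by (simp add: sum.remove[where x=i])
  \<comment> \<open>Stated for an arbitrary starting index \<beta>, which grows as the list is
    consumed.\<close>
  have step: "(\<integral>x. D \<beta> x * iter_partial is \<phi> x \<partial>lebesgue)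
      = (-1) ^ length is * (\<integral>x. D (\<lambda>i. \<beta> i + count_list is i) x * \<phi> x \<partial>lebesgue)"
    if "test_fn \<phi>" "sum \<beta> UNIV + length is \<le> 2" for \<phi> "is" \<beta>
    using that(2)
  proof (induction "is" arbitrary: \<beta>)
    case Nil
    then show ?case by simp
  next
    case (Cons i "is")
    let ?\<gamma> = "\<beta>(i := Suc (\<beta> i))"
    have s: "sum ?\<gamma> UNIV + length is \<le> 2" using Cons.prems sum_upd[of \<beta> i] by simp
    have "(\<integral>x. D \<beta> x * iter_partial (i # is) \<phi> x \<partial>lebesgue)
      = - (\<integral>x. D ?\<gamma> x * iter_partial is \<phi> x \<partial>lebesgue)"
      using Cons.prems s by (intro integration_by_parts_test_fn cont deriv that(1)) auto
    also have "\<dots> = - ((-1) ^ length is * (\<integral>x. D (\<lambda>j. ?\<gamma> j + count_list is j) x * \<phi> x \<partial>lebesgue))"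
      by (simp only: Cons.IH[OF s])
    also have "(\<lambda>j. ?\<gamma> j + count_list is j) = (\<lambda>j. \<beta> j + count_list (i # is) j)"
      by (auto simp: fun_eq_iff)
    finally show ?case by simp
  qed
  have "weak_deriv (D (\<lambda>_. 0)) \<alpha> (D \<alpha>)" if \<alpha>: "sum \<alpha> UNIV \<le> 2" for \<alpha>
    unfolding weak_deriv_def
  proof (intro allI impI)
    fix \<phi> :: "real^'n \<Rightarrow> real" and "is" assume \<phi>: "test_fn \<phi>" and count: "\<forall>i. count_list is i = \<alpha> i"
    have "length is = (\<Sum>i\<in>set is. count_list is i)" by (simp add: sum_count_set)
    also have "\<dots> = sum \<alpha> UNIV"
      using count by (intro sum.mono_neutral_cong_left) (auto simp: count_list_0_iff[symmetric])
    finally have len: "length is = sum \<alpha> UNIV" .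
    have "count_list is = \<alpha>" using count by auto
    then show "(\<integral>x. D (\<lambda>_. 0) x * iter_partial is \<phi> x \<partial>lebesgue)
      = (-1) ^ sum \<alpha> UNIV * (\<integral>x. D \<alpha> x * \<phi> x \<partial>lebesgue)"
      using step[OF \<phi>, of "\<lambda>_. 0" "is"] len \<alpha> by simp
  qed
  then show ?thesis unfolding W21loc_with_def using cont by (auto intro: loc_int_continuous)
qed

section \<open>Tensor products of bumps\<close>

text \<open>The function max 0 (t * (1 - t)) ^ 3, supported on the unit interval, and its derivatives of order 1 and 2.
The third clause is meaningful only for order 2.\<close>

fun bump :: "nat \<Rightarrow> real \<Rightarrow> real" where
  "bump 0 t = max 0 (t * (1 - t)) ^ 3"
| "bump (Suc 0) t = 3 * max 0 (t * (1 - t)) ^ 2 * (1 - 2 * t)"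
| "bump (Suc (Suc r)) t = 6 * max 0 (t * (1 - t)) * (1 - 2 * t)\<^sup>2 - 6 * (max 0 (t * (1 - t)))\<^sup>2"

text \<open>An exponent of at least 2 removes the kink: at 0 the difference quotient is bounded by a
  positive power of |h|.\<close>

lemma DERIV_max_0_power:
  fixes y :: real
  shows "((\<lambda>y. max 0 y ^ Suc (Suc n)) has_field_derivative real (Suc (Suc n)) * max 0 y ^ Suc n) (at y)"
proof (cases "y = 0")
  case True
  have "((\<lambda>h::real. max 0 h ^ Suc (Suc n) / h) \<longlongrightarrow> 0) (at 0)"
  proof (rule Lim_null_comparison)
    show "\<forall>\<^sub>F h::real in at 0. norm (max 0 h ^ Suc (Suc n) / h) \<le> \<bar>h\<bar> ^ Suc n"
    proof (rule always_eventually, rule allI)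
      fix h :: real
      show "norm (max 0 h ^ Suc (Suc n) / h) \<le> \<bar>h\<bar> ^ Suc n" 
      proof (cases "0 < h")
        case False
        then have "max 0 h = 0" by simp
        then have "norm (max 0 h ^ Suc (Suc n) / h) = 0" by simp
        then show ?thesis by (simp only: zero_le_power abs_ge_zero)
      qed (simp add: max_def)
    qed
    have "((\<lambda>h::real. \<bar>h\<bar> ^ Suc n) \<longlongrightarrow> \<bar>0\<bar> ^ Suc n) (at 0)" by (intro tendsto_intros)
    then show "((\<lambda>h::real. \<bar>h\<bar> ^ Suc n) \<longlongrightarrow> 0) (at 0)" by simp
  qed
  then show ?thesis using True by (simp add: has_field_derivative_iff)
next
  case False
  then consider "0 < y" | "y < 0" by linarith
  then show ?thesis
  proof cases
    case 1
    have "((\<lambda>y. y ^ Suc (Suc n)) has_field_derivative real (Suc (Suc n)) * max 0 y ^ Suc n) (at y)"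
      using DERIV_pow[of "Suc (Suc n)" y] 1 by (simp add: max_def)
    then show ?thesis
      by (rule has_field_derivative_transform_within_open[of _ _ _ "{0<..}"]) (use 1 in auto)
  next
    case 2
    have "((\<lambda>y. 0) has_field_derivative real (Suc (Suc n)) * max 0 y ^ Suc n) (at y)"
      using 2 by simp
    then show ?thesis
      by (rule has_field_derivative_transform_within_open[of _ _ _ "{..<0}"]) (use 2 in auto)
  qed
qed

lemma DERIV_bump:
  assumes "r \<le> 1"
  shows "(bump r has_field_derivative bump (Suc r) t) (at t)"
proof -
  have q: "((\<lambda>t::real. t * (1 - t)) has_field_derivative 1 - 2 * t) (at t)"
    by (auto intro!: derivative_eq_intros)
  have l: "((\<lambda>t::real. 1 - 2 * t) has_field_derivative - 2) (at t)"
    by (auto intro!: derivative_eq_intros)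
  have p3: "((\<lambda>t. max 0 (t * (1 - t)) ^ 3) has_field_derivative
      3 * max 0 (t * (1 - t)) ^ 2 * (1 - 2 * t)) (at t)"
    using DERIV_chain2[OF DERIV_max_0_power[of 1] q] by (simp add: numeral_3_eq_3 numeral_2_eq_2)
  have p2: "((\<lambda>t. max 0 (t * (1 - t)) ^ 2) has_field_derivative
      2 * max 0 (t * (1 - t)) * (1 - 2 * t)) (at t)"
    using DERIV_chain2[OF DERIV_max_0_power[of 0] q] by (simp add: numeral_2_eq_2)
  have sq: "max 0 (t * (1 - t)) * (max 0 (t * (1 - t))) = max 0 (t * (1 - t))^2"
    by (simp add: power2_eq_square)
  consider "r = 0" | "r = 1" using assms by linarith
  then show ?thesis
  proof cases
    case 1
    then show ?thesis using p3 by (simp add: bump.simps[abs_def])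
  next
    case 2
    have "((\<lambda>t. 3 * (max 0 (t * (1 - t)) ^ 2 * (1 - 2 * t))) has_field_derivative
      3 * ((2 * max 0 (t * (1 - t)) * (1 - 2 * t)) * (1 - 2 * t) + (- 2) * max 0 (t * (1 - t)) ^ 2)) (at t)"
      by (rule DERIV_cmult[OF DERIV_mult[OF p2 l]])
    moreover have "bump r = (\<lambda>t. 3 * (max 0 (t * (1 - t)) ^ 2 * (1 - 2 * t)))"
      using 2 by (simp add: fun_eq_iff mult.assoc)
    moreover have "bump (Suc r) t =
      3 * ((2 * max 0 (t * (1 - t)) * (1 - 2 * t)) * (1 - 2 * t) + (- 2) * max 0 (t * (1 - t)) ^ 2)"
      using 2 by (simp add: power2_eq_square algebra_simps)
    ultimately show ?thesis by simp
  qed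
qed

lemma continuous_on_bump: "continuous_on S (bump r)"
proof -
  consider "r = 0" | "r = Suc 0" | n where "r = Suc (Suc n)" by (metis not0_implies_Suc)
  then show ?thesis by cases (auto simp: bump.simps[abs_def] intro!: continuous_intros)
qed

lemma bump_eq_0:
  assumes "t \<notin> {0<..<1}" shows "bump r t = 0"
proof -
  have "t * (1 - t) \<le> 0" using assms by (auto simp: mult_le_0_iff)
  then have "max 0 (t * (1 - t)) = 0" by simp
  then show ?thesis by (induction r t rule: bump.induct) (simp_all only: bump.simps, auto)
qed

text \<open>Let q = t(1-t) <= 1/4; also |1-2t| <= 1. The constant 3 is the coefficient in order 1;
  in order 2 both terms lie between 0 and 3/2.\<close>

lemma abs_bump_le: "\<bar>bump r t\<bar> \<le> 3"
proof (cases "t \<in> {0<..<1}")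
  case True
  define q where "q = max 0 (t * (1 - t))"
  define s where "s = 1 - 2 * t"
  have q: "0 \<le> q" "q \<le> 1" "s\<^sup>2 \<le> 1" "\<bar>s\<bar> \<le> 1" "q \<le> 1/4"
    using True sum_squares_ge_zero[of "t - 1/2" 0] unfolding q_def s_def
    by (auto simp: max_def abs_le_iff power2_eq_square algebra_simps abs_square_le_1[unfolded power2_eq_square])
  have q2: "0 \<le> q\<^sup>2" "q\<^sup>2 \<le> q" using q by (auto simp: power2_eq_square mult_left_le_one_le)
  have q3: "0 \<le> q^3" "q^3 \<le> 1" using q by (auto simp: power_le_one)
  have qs: "0 \<le> q * s\<^sup>2" "q * s\<^sup>2 \<le> q" using q by (auto simp: mult_left_le)
  have q2s: "\<bar>q\<^sup>2 * s\<bar> \<le> 1"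
    unfolding abs_mult using q q2 by (intro mult_le_one) auto
  consider "r = 0" | "r = Suc 0" | n where "r = Suc (Suc n)" by (metis not0_implies_Suc)
  then show ?thesis
  proof cases
    case 1 then show ?thesis using q3 by (simp add: q_def[symmetric])
  next
    case 2 then show ?thesis using q2s by (simp add: q_def[symmetric] s_def[symmetric] mult.assoc abs_mult)
  next
    case 3
    have "\<bar>6 * (q * s\<^sup>2) - 6 * q\<^sup>2\<bar> \<le> 3" using qs q2 q by linarith
    then show ?thesis using 3 by (simp add: q_def s_def mult.assoc)
  qed
next
  case False
  then show ?thesis by (simp add: bump_eq_0)
qed

text \<open>The interval stays away from 0 and from the peak at 1/2, where the derivative vanishes.
  On it t(1-t) >= 7/64 and 1-2t >= 1/4; the smallest resulting bound is (7/64)^3, just above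
  1/1000.\<close>

lemma bump_ge:
  assumes "t \<in> {1/8<..<3/8}" "r \<le> 1" shows "1 / 1000 \<le> bump r t"
proof -
  have "(7/64::real) \<le> t * (1 - t)"
  proof -
    have "0 \<le> (t - 1/8) * (7/8 - t)" using assms by (intro mult_nonneg_nonneg) auto
    moreover have "(t - 1/8) * (7/8 - t) = t * (1 - t) - 7/64" by (simp add: field_simps)
    ultimately show ?thesis by simp
  qed
  then have q: "7/64 \<le> max 0 (t * (1 - t))" by simp
  consider "r = 0" | "r = 1" using assms by linarith
  then show ?thesis
  proof cases
    case 1
    have "(7/64)^3 \<le> max 0 (t * (1 - t))^3" using q by (intro power_mono) auto
    then show ?thesis using 1 by (simp add: power3_eq_cube)
  next
    case 2
    have "(7/64)^2 * (1/4) \<le> max 0 (t * (1 - t))^2 * (1 - 2 * t)"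
      using q assms by (intro mult_mono power_mono) auto
    then show ?thesis using 2 by (simp add: power2_eq_square)
  qed
qed

text \<open>\<open>W j r\<close> stands for the r-th derivative of the j-th factor. Along axis i
  only the factor with index i varies.\<close>

lemma tensor_product_derivs:
  fixes W :: "'n::finite \<Rightarrow> nat \<Rightarrow> real \<Rightarrow> real"
  assumes cont: "\<And>j r. r \<le> 2 \<Longrightarrow> continuous_on UNIV (W j r)"
    and deriv: "\<And>j r t. r \<le> 1 \<Longrightarrow> (W j r has_field_derivative W j (Suc r) t) (at t)"
  defines "D \<equiv> \<lambda>\<alpha> x. \<Prod>j\<in>UNIV. W j (\<alpha> j) (x $ j)"
  shows "sum \<alpha> UNIV \<le> 2 \<Longrightarrow> continuous_on UNIV (D \<alpha>)"
    and "sum \<alpha> UNIV \<le> 1 \<Longrightarrow>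
      ((\<lambda>t. D \<alpha> (x + t *\<^sub>R axis i 1)) has_field_derivative D (\<alpha>(i := Suc (\<alpha> i))) x) (at 0)"
proof -
  have le: "\<alpha> j \<le> sum \<alpha> UNIV" for j by (rule member_le_sum) auto
  show "continuous_on UNIV (D \<alpha>)" if "sum \<alpha> UNIV \<le> 2"
    unfolding D_def using le that
    by (intro continuous_on_prod continuous_on_compose2[OF cont] continuous_intros) (auto intro: order_trans)
  assume s: "sum \<alpha> UNIV \<le> 1"
  let ?P = "\<Prod>j\<in>UNIV - {i}. W j (\<alpha> j) (x $ j)"
  have 1: "D \<alpha> (x + t *\<^sub>R axis i 1) = W i (\<alpha> i) (x $ i + t) * ?P" for t
    unfolding D_def by (subst prod.remove[of _ i]) (auto simp: axis_def intro!: prod.cong)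
  have 2: "D (\<alpha>(i := Suc (\<alpha> i))) x = W i (Suc (\<alpha> i)) (x $ i) * ?P"
    unfolding D_def by (subst prod.remove[of _ i]) (auto intro!: prod.cong)
  have "(W i (\<alpha> i) has_field_derivative W i (Suc (\<alpha> i)) (x $ i)) (at (x $ i + 0))"
    using deriv[of "\<alpha> i" i "x $ i"] le[of i] s by simp
  then have "((\<lambda>t. W i (\<alpha> i) (x $ i + t)) has_field_derivative W i (Suc (\<alpha> i)) (x $ i)) (at 0)"
    using DERIV_shift[of "W i (\<alpha> i)" "W i (Suc (\<alpha> i)) (x $ i)" 0 "x $ i"] by (simp add: add.commute)
  then show "((\<lambda>t. D \<alpha> (x + t *\<^sub>R axis i 1)) has_field_derivative D (\<alpha>(i := Suc (\<alpha> i))) x) (at 0)"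
    unfolding 1 2 by (rule DERIV_cmult_right)
qed

text \<open>The derivative of order r of a sum of bumps of height A k and width m k placed at p k.\<close>

definition comb :: "'k set \<Rightarrow> ('k \<Rightarrow> real) \<Rightarrow> ('k \<Rightarrow> real) \<Rightarrow> ('k \<Rightarrow> real) \<Rightarrow> nat \<Rightarrow> real \<Rightarrow> real" where
  "comb I A p m r t = (\<Sum>k\<in>I. A k / m k ^ r * bump r ((t - p k) / m k))"

lemma continuous_on_comb:
  assumes "\<forall>k\<in>I. 0 < m k"
  shows "continuous_on S (comb I A p m r)"
  unfolding comb_def[abs_def] using assms
  by (intro continuous_intros continuous_on_compose2[OF continuous_on_bump[of UNIV]]) auto

lemma DERIV_comb:
  assumes "\<forall>k\<in>I. 0 < m k" "r \<le> 1"
  shows "(comb I A p m r has_field_derivative comb I A p m (Suc r) t) (at t)"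
  unfolding comb_def[abs_def]
proof (rule DERIV_sum)
  fix k assume "k \<in> I"
  then have m: "0 < m k" using assms by auto
  have 1: "((\<lambda>t. (t - p k) / m k) has_field_derivative 1 / m k) (at t)"
    using m by (auto intro!: derivative_eq_intros)
  show "((\<lambda>t. A k / m k ^ r * bump r ((t - p k) / m k)) has_field_derivative
     A k / m k ^ Suc r * bump (Suc r) ((t - p k) / m k)) (at t)"
    using DERIV_cmult[OF DERIV_chain2[OF DERIV_bump[OF assms(2)] 1], of "A k / m k ^ r"] m
    by (simp add: field_simps)
qed

lemma comb_in:
  assumes "finite I" "\<forall>k\<in>I. 0 < m k" "disjoint_family_on (\<lambda>k. {p k<..p k + m k}) I"
    and k: "k \<in> I" "t \<in> {p k<..p k + m k}"
  shows "comb I A p m r t = A k / m k ^ r * bump r ((t - p k) / m k)"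
proof -
  have "A l / m l ^ r * bump r ((t - p l) / m l) = 0" if l: "l \<in> I - {k}" for l
  proof -
    have "t \<notin> {p l<..p l + m l}" using disjoint_family_onD[OF assms(3), of k l] k l by blast
    moreover have "0 < m l" using assms(2) l by auto
    ultimately have "(t - p l) / m l \<notin> {0<..<1}" by (auto simp: field_simps)
    then show ?thesis by (simp add: bump_eq_0)
  qed
  then have "(\<Sum>l\<in>I - {k}. A l / m l ^ r * bump r ((t - p l) / m l)) = 0"
    by (intro sum.neutral) blast
  then show ?thesis
    unfolding comb_def using assms(1) k(1) by (subst sum.remove[of _ k]) simp_all
qed

text \<open>The bumps vanish at both end points too, so the intervals can be open, in agreement with
  the open boxes \<open>cell\<close>.\<close>

lemma comb_out:
  assumes "\<forall>k\<in>I. 0 < m k" "\<And>k. k \<in> I \<Longrightarrow> t \<notin> {p k<..<p k + m k}"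
  shows "comb I A p m r t = 0"
  unfolding comb_def
proof (rule sum.neutral, rule ballI)
  fix k assume k: "k \<in> I"
  then have "(t - p k) / m k \<notin> {0<..<1}" using assms(1) assms(2)[OF k] by (auto simp: field_simps)
  then show "A k / m k ^ r * bump r ((t - p k) / m k) = 0" by (simp add: bump_eq_0)
qed

text \<open>With lo = 0 and hi = 1 this is the box on which one product of bumps lives; with 1/8 and
  3/8 it is the part where \<open>bump_ge\<close> applies to every factor.\<close>

definition cell :: "'n::finite \<Rightarrow> real \<Rightarrow> real \<Rightarrow> real \<Rightarrow> real \<Rightarrow> (real^'n) set" where
  "cell i lo hi p m = box (\<chi> j. if j = i then p + lo * m else lo) (\<chi> j. if j = i then p + hi * m else hi)"

lemma emeasure_cell:
  fixes i :: "'n::finite"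
  assumes "lo \<le> hi" "0 \<le> m"
  shows "emeasure lebesgue (cell i lo hi p m) = ennreal (m * (hi - lo) ^ CARD('n))"
proof -
  let ?a = "(\<chi> j. if j = i then p + lo * m else lo) :: real^'n"
  let ?b = "(\<chi> j. if j = i then p + hi * m else hi) :: real^'n"
  have le: "\<And>b. b \<in> Basis \<Longrightarrow> ?a \<bullet> b \<le> ?b \<bullet> b"
    using assms by (auto simp: Basis_vec_def inner_axis mult_right_mono)
  have B: "(Basis :: (real^'n) set) = (\<lambda>i. axis i 1) ` UNIV"
    by (auto simp: Basis_vec_def)
  have "(\<Prod>b\<in>Basis. (?b - ?a) \<bullet> b) = (\<Prod>j\<in>UNIV. (?b - ?a) \<bullet> axis j 1)"
    unfolding B by (subst prod.reindex) (auto simp: inj_on_def axis_eq_axis)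
  also have "\<dots> = ((hi - lo) * m) * (\<Prod>j\<in>UNIV - {i}. hi - lo)"
    by (subst prod.remove[of _ i]) (auto simp: inner_axis algebra_simps intro!: prod.cong)
  also have "\<dots> = m * ((hi - lo) * (hi - lo) ^ (CARD('n) - 1))"
    by (simp add: card_Diff_singleton)
  also have "\<dots> = m * (hi - lo) ^ CARD('n)"
    by (simp add: power_eq_if)
  finally show ?thesis using emeasure_lborel_box[OF le] by (simp add: cell_def)
qed

lemma mem_cell:
  assumes "0 < m"
  shows "x \<in> cell i lo hi p m \<longleftrightarrow> (x $ i - p) / m \<in> {lo<..<hi} \<and> (\<forall>j. j \<noteq> i \<longrightarrow> x $ j \<in> {lo<..<hi})"
  using assms by (auto simp: cell_def mem_box_cart field_simps split: if_splits)

lemma cell_subset: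
  assumes "0 < m" "0 \<le> lo" "hi \<le> 1" "x \<in> cell i lo hi p m"
  shows "x $ i \<in> {p<..<p + m}"
proof -
  have "(x $ i - p) / m \<in> {lo<..<hi}" using assms mem_cell by blast
  then have "lo < (x $ i - p) / m" "(x $ i - p) / m < hi" by simp_all
  then have "0 < (x $ i - p) / m" "(x $ i - p) / m < 1" using assms(2,3) by linarith+
  then show ?thesis using assms(1) by (simp_all add: field_simps)
qed

section \<open>The interpolation inequality on step functions\<close>

lemma ennsqrt_mono:
  assumes "a \<le> b" shows "ennsqrt a \<le> ennsqrt b"
proof (cases "b = \<infinity>")
  case False
  then have "b < \<infinity>" by (simp add: less_top)
  moreover then have "a < \<infinity>" using assms le_less_trans by blast
  ultimately show ?thesis using assms
    by (auto simp: ennsqrt_def intro!: ennreal_leI real_sqrt_le_mono enn2real_mono)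
qed (simp add: ennsqrt_def)

lemma ennsqrt_cmult:
  assumes "0 < r" shows "ennsqrt (ennreal r * a) = ennreal (sqrt r) * ennsqrt a"
proof (cases a)
  case (real x)
  then show ?thesis using assms
    by (simp add: ennsqrt_def ennreal_mult[symmetric] real_sqrt_mult)
next
  case top
  then show ?thesis using assms by (simp add: ennsqrt_def ennreal_mult_top)
qed

lemma ennsqrt_less_top: "a < \<infinity> \<Longrightarrow> ennsqrt a < \<infinity>"
  by (simp add: ennsqrt_def)

lemma finite_multi_indices: "finite {\<alpha> :: 'n::finite \<Rightarrow> nat. sum \<alpha> UNIV = k}"
proof (rule finite_subset)
  show "{\<alpha> :: 'n \<Rightarrow> nat. sum \<alpha> UNIV = k} \<subseteq> (UNIV :: 'n set) \<rightarrow>\<^sub>E {..k}"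
    by (auto intro!: member_le_sum)
qed (simp add: finite_PiE)

text \<open>Disjointness is inherited from the slots through coordinate i. For lo = 0 and hi = 1 the
  measures are m k; for 1/8 and 3/8 they are smaller by 4 to the dimension.\<close>

lemma packing_cell:
  fixes i :: "'n::finite"
  assumes "finite I" "\<forall>k\<in>I. 0 < m k" "0 \<le> lo" "lo \<le> hi" "hi \<le> 1"
  shows "packing lebesgue I (\<lambda>k. m k * (hi - lo) ^ CARD('n)) (\<lambda>k. cell i lo hi (place I m k) (m k))"
proof -
  have m: "\<forall>k\<in>I. 0 \<le> m k" using assms by auto
  have "disjoint_family_on (\<lambda>k. cell i lo hi (place I m k) (m k)) I"
    unfolding disjoint_family_on_def
  proof (intro ballI impI)
    fix k l assume kl: "k \<in> I" "l \<in> I" "k \<noteq> l"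
    have "x \<notin> cell i lo hi (place I m l) (m l)" if "x \<in> cell i lo hi (place I m k) (m k)" for x
    proof
      assume "x \<in> cell i lo hi (place I m l) (m l)"
      then have "x $ i \<in> slot I m l" "x $ i \<in> slot I m k"
        using cell_subset[OF _ assms(3,5)] that kl assms(2) unfolding slot_def by fastforce+
      then show False using disjoint_family_onD[OF disjoint_slot[OF assms(1) m] kl] by blast
    qed
    then show "cell i lo hi (place I m k) (m k) \<inter> cell i lo hi (place I m l) (m l) = {}" by blast
  qed
  then show ?thesis
    using assms(2,4) emeasure_cell[of lo hi _ i] by (auto simp: packing_def cell_def less_imp_le)
qed

text \<open>One bump for each step: its width in direction i is m k, and 1 in the other directions.
The hypotheses say that m k is comparable to l * sqrt (b k / a k).\<close>

lemma interpolation_on_short_steps: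
  fixes Y Z B :: "(real \<Rightarrow> real) \<Rightarrow> ennreal" and C :: real and a b m :: "'k \<Rightarrow> real"
  assumes Y: "is_ri_bfs Y" and Z: "is_ri_bfs Z" and B: "is_ri_bfs B" and C: "C > 0"
    and ineq: "\<And>(u :: real^'n::finite \<Rightarrow> real) D. W21loc_with u D \<Longrightarrow> rmem Z u \<Longrightarrow>
        rnorm B (grad_abs 1 D) \<le> ennreal C * ennsqrt (rnorm Y (grad_abs 2 D)) * ennsqrt (rnorm Z u)"
    and I: "finite I" and pos: "\<forall>k\<in>I. 0 < m k \<and> 0 < a k \<and> 0 < b k"
    and l: "0 < l" and m1: "\<forall>k\<in>I. m k \<le> 1"
    and lower: "\<forall>k\<in>I. m k * sqrt (a k * b k) \<le> l * b k"
    and upper: "\<forall>k\<in>I. sqrt (a k * b k) \<le> 2 / l * a k * m k"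
    and fin: "step_norm Z I b m < \<infinity>"
  shows "step_norm B I (\<lambda>k. sqrt (a k * b k)) m
    \<le> ennreal (12000 ^ CARD('n) * C * sqrt (2 * real (card {\<alpha> :: 'n \<Rightarrow> nat. sum \<alpha> UNIV = 2})))
        * ennsqrt (step_norm Y I a m) * ennsqrt (step_norm Z I b m)"
proof -
  \<comment> \<open>An arbitrary coordinate direction, fixed as the thin one.\<close>
  define i :: 'n where "i = undefined"
  let ?n = "CARD('n)"
  define P where "P = real (card {\<alpha> :: 'n \<Rightarrow> nat. sum \<alpha> UNIV = 2})"
  have P: "0 < P"
  proof -
    \<comment> \<open>The multi-index of two derivatives in direction i.\<close>
    have "(\<lambda>j. if j = i then 2 else 0) \<in> {\<alpha> :: 'n \<Rightarrow> nat. sum \<alpha> UNIV = 2}" by simp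
    then show ?thesis unfolding P_def using finite_multi_indices card_gt_0_iff
      by (metis empty_iff of_nat_0_less_iff)
  qed
  have mpos: "\<forall>k\<in>I. 0 < m k" and m0: "\<forall>k\<in>I. 0 \<le> m k" using pos by (auto simp: less_imp_le)
  define f where "f k = sqrt (a k * b k)" for k
  have f0: "0 < f k" if "k \<in> I" for k using pos that by (simp add: f_def)
  define p where "p = place I m"
  have dis: "disjoint_family_on (\<lambda>k. {p k<..p k + m k}) I"
    using disjoint_slot[OF I m0] by (simp add: p_def slot_def[abs_def])
  \<comment> \<open>The height m k * f k makes the derivative of order r in direction i of size f k
    times m k to the power 1 - r.\<close>
  define W where "W j r = (if j = i then comb I (\<lambda>k. m k * f k) p m r else bump r)" for j :: 'n and r
  define D where "D \<alpha> x = (\<Prod>j\<in>UNIV. W j (\<alpha> j) (x $ j))" for \<alpha> and x :: "real^'n"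
  have Wc: "continuous_on UNIV (W j r)" for j r
    by (simp add: W_def continuous_on_comb[OF mpos] continuous_on_bump)
  have Wd: "(W j r has_field_derivative W j (Suc r) t) (at t)" if "r \<le> 1" for j r t
    using that by (simp add: W_def DERIV_comb[OF mpos] DERIV_bump)
  have Dc: "continuous_on UNIV (D \<alpha>)" if "sum \<alpha> UNIV \<le> 2" for \<alpha>
    unfolding D_def[abs_def] by (rule tensor_product_derivs(1)[of W, OF Wc Wd that])
  have W21: "W21loc_with (D (\<lambda>_. 0)) D"
    by (rule W21loc_with_classical[OF Dc], assumption)
      (unfold D_def[abs_def], rule tensor_product_derivs(2)[of W, OF Wc Wd])
  have Dm: "D \<alpha> \<in> borel_measurable lebesgue" if "sum \<alpha> UNIV \<le> 2" for \<alpha>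
    using Dc[OF that] by (simp add: borel_measurable_continuous_onI measurable_completion)
  have gm: "grad_abs k D \<in> borel_measurable lebesgue" if "k \<le> 2" for k
    unfolding grad_abs_def[abs_def] using Dm that by (intro borel_measurable_sum borel_measurable_abs) auto

  define E where "E k = cell i 0 1 (p k) (m k)" for k
  define E' where "E' k = cell i (1/8) (3/8) (p k) (m k)" for k
  have packE: "packing lebesgue I m E"
    using packing_cell[OF I mpos, of 0 1 i] by (simp add: E_def[abs_def] p_def)
  have packE': "packing lebesgue I (\<lambda>k. m k / real (4 ^ ?n)) E'"
    using packing_cell[OF I mpos, of "1/8" "3/8" i]
    by (simp add: E'_def[abs_def] p_def power_one_over divide_inverse[symmetric])
  have D_in: "D \<alpha> x = m k * f k / m k ^ \<alpha> i * (bump (\<alpha> i) ((x $ i - p k) / m k) *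
      (\<Prod>j\<in>UNIV - {i}. bump (\<alpha> j) (x $ j)))" if "k \<in> I" "x \<in> E k" for \<alpha> k x
  proof -
    have "x $ i \<in> {p k<..p k + m k}" using cell_subset[of "m k" 0 1 x i "p k"] that mpos by (auto simp: E_def)
    then have "W i (\<alpha> i) (x $ i) = m k * f k / m k ^ \<alpha> i * bump (\<alpha> i) ((x $ i - p k) / m k)"
      using comb_in[OF I mpos dis that(1)] by (simp add: W_def)
    then show ?thesis unfolding D_def
      by (subst prod.remove[of _ i]) (auto simp: W_def intro!: prod.cong)
  qed
  have D_out: "D \<alpha> x = 0" if x: "\<And>k. k \<in> I \<Longrightarrow> x \<notin> E k" for \<alpha> x
  proof (cases "\<forall>j. j \<noteq> i \<longrightarrow> x $ j \<in> {0<..<1}")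
    case True
    have "x $ i \<notin> {p k<..<p k + m k}" if "k \<in> I" for k
    proof
      assume "x $ i \<in> {p k<..<p k + m k}"
      then have "(x $ i - p k) / m k \<in> {0<..<1}" using mpos that by (auto simp: field_simps)
      then show False using x[OF that] True mpos that by (auto simp: E_def mem_cell)
    qed
    then have "W i (\<alpha> i) (x $ i) = 0" by (simp add: W_def comb_out[OF mpos])
    then show ?thesis unfolding D_def by (intro prod_zero) auto
  next
    case False
    then obtain j where "j \<noteq> i" "x $ j \<notin> {0<..<1}" by blast
    then have "W j (\<alpha> j) (x $ j) = 0" by (simp add: W_def bump_eq_0)
    then show ?thesis unfolding D_def by (intro prod_zero) auto
  qed
  have D_le: "\<bar>D \<alpha> x\<bar> \<le> m k * f k / m k ^ \<alpha> i * 3 ^ ?n" if "k \<in> I" "x \<in> E k" for \<alpha> k x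
  proof -
    have "\<bar>bump (\<alpha> i) ((x $ i - p k) / m k) * (\<Prod>j\<in>UNIV - {i}. bump (\<alpha> j) (x $ j))\<bar>
      \<le> 3 * (\<Prod>j\<in>UNIV - {i}. 3)"
      unfolding abs_mult abs_prod by (intro mult_mono abs_bump_le prod_mono conjI) (auto intro: prod_nonneg)
    also have "\<dots> = 3 ^ ?n" by (simp add: card_Diff_singleton power_eq_if)
    finally show ?thesis unfolding D_in[OF that] abs_mult
      using f0[OF that(1)] mpos that(1) by (intro mult_mono) (auto simp: less_imp_le)
  qed
  have disE: "disjoint_family_on E I" "disjoint_family_on E' I"
    using packE packE' by (auto simp: packing_def)

  have Zle: "rnorm Z (D (\<lambda>_. 0)) \<le> ennreal (l * 3 ^ ?n) * step_norm Z I b m"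
  proof -
    have "\<bar>D (\<lambda>_. 0) x\<bar> \<le> \<bar>step_fn I (\<lambda>k. (l * 3 ^ ?n) * b k) E x\<bar>" for x
    proof (cases "\<exists>k\<in>I. x \<in> E k")
      case True
      then obtain k where k: "k \<in> I" "x \<in> E k" by blast
      have "\<bar>D (\<lambda>_. 0) x\<bar> \<le> m k * f k * 3 ^ ?n"
        using D_le[OF k, of "\<lambda>_. 0"] by simp
      also have "\<dots> \<le> l * b k * 3 ^ ?n"
        using lower k by (intro mult_right_mono) (auto simp: f_def)
      also have "\<dots> = l * 3 ^ ?n * b k" by simp
      finally show ?thesis unfolding step_fn_in[OF I disE(1) k] by linarith
    next
      case False
      then show ?thesis using D_out by auto
    qed
    then have "rnorm Z (D (\<lambda>_. 0)) \<le> step_norm Z I (\<lambda>k. (l * 3 ^ ?n) * b k) m"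
      by (intro rnorm_le_step_norm[OF Z I m0 _ packE] Dm) auto
    then show ?thesis using step_norm_cmult[OF Z I m0, of "l * 3 ^ ?n"] l by simp
  qed
  have Yle: "rnorm Y (grad_abs 2 D) \<le> ennreal (2 / l * 3 ^ ?n * P) * step_norm Y I a m"
  proof -
    have "\<bar>grad_abs 2 D x\<bar> \<le> \<bar>step_fn I (\<lambda>k. (2 / l * 3 ^ ?n * P) * a k) E x\<bar>" for x
    proof (cases "\<exists>k\<in>I. x \<in> E k")
      case True
      then obtain k where k: "k \<in> I" "x \<in> E k" by blast
      have mk: "0 < m k" "m k \<le> 1" using k mpos m1 by auto
      have "\<bar>D \<alpha> x\<bar> \<le> 2 / l * a k * 3 ^ ?n" if "sum \<alpha> UNIV = 2" for \<alpha>
      proof -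
        have "\<alpha> i \<le> 2" using that member_le_sum[of i UNIV \<alpha>] by simp
        \<comment> \<open>Here m k <= 1 enters: among the second-order derivatives, the one taken
          twice in the thin direction has the largest bound.\<close>
        then have "m k ^ 2 \<le> m k ^ \<alpha> i" using mk by (intro power_decreasing) auto
        then have "m k * f k / m k ^ \<alpha> i \<le> m k * f k / m k ^ 2"
          using mk f0[OF k(1)] by (intro divide_left_mono) (auto simp: less_imp_le)
        also have "\<dots> = f k / m k" using mk by (simp add: power2_eq_square)
        also have "\<dots> \<le> 2 / l * a k"
          using upper k mk by (simp add: f_def divide_le_eq)
        finally have "m k * f k / m k ^ \<alpha> i * 3 ^ ?n \<le> 2 / l * a k * 3 ^ ?n"
          by (intro mult_right_mono) auto
        then show ?thesis using D_le[OF k, of \<alpha>] by simp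
      qed
      then have "grad_abs 2 D x \<le> (\<Sum>\<alpha>\<in>{\<alpha> :: 'n \<Rightarrow> nat. sum \<alpha> UNIV = 2}. 2 / l * a k * 3 ^ ?n)"
        unfolding grad_abs_def by (intro sum_mono) auto
      also have "\<dots> = (2 / l * 3 ^ ?n * P) * a k" by (simp add: P_def algebra_simps)
      finally have "grad_abs 2 D x \<le> (2 / l * 3 ^ ?n * P) * a k" .
      moreover have "0 \<le> grad_abs 2 D x" unfolding grad_abs_def by (intro sum_nonneg) auto
      ultimately show ?thesis unfolding step_fn_in[OF I disE(1) k] by linarith
    next
      case False
      then have "grad_abs 2 D x = 0" unfolding grad_abs_def using D_out by (intro sum.neutral) auto
      then show ?thesis by simp
    qed
    then have "rnorm Y (grad_abs 2 D) \<le> step_norm Y I (\<lambda>k. (2 / l * 3 ^ ?n * P) * a k) m"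
      by (intro rnorm_le_step_norm[OF Y I m0 _ packE] gm) auto
    then show ?thesis using step_norm_cmult[OF Y I m0, of "2 / l * 3 ^ ?n * P"] l P by simp
  qed
  have Bge: "ennreal ((1/1000) ^ ?n) * step_norm B I f (\<lambda>k. m k / real (4 ^ ?n)) \<le> rnorm B (grad_abs 1 D)"
  proof -
    have "\<bar>step_fn I (\<lambda>k. (1/1000) ^ ?n * f k) E' x\<bar> \<le> \<bar>grad_abs 1 D x\<bar>" for x
    proof (cases "\<exists>k\<in>I. x \<in> E' k")
      case True
      then obtain k where k: "k \<in> I" "x \<in> E' k" by blast
      have mk: "0 < m k" using k mpos by auto
      have x: "(x $ i - p k) / m k \<in> {1/8<..<3/8}" "\<And>j. j \<noteq> i \<Longrightarrow> x $ j \<in> {1/8<..<3/8}"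
        using k(2)[unfolded E'_def mem_cell[OF mk]] by blast+
      moreover have "{1/8<..<3/8::real} \<subseteq> {0<..<1}" by auto
      ultimately have kE: "x \<in> E k" unfolding E_def mem_cell[OF mk] by blast
      \<comment> \<open>The first derivative in direction i alone bounds the gradient from
        below.\<close>
      let ?\<alpha> = "\<lambda>j. if j = i then 1 else 0 :: nat"
      have "(1/1000) ^ ?n = 1/1000 * (\<Prod>j\<in>UNIV - {i}. 1/1000 :: real)"
        by (simp add: card_Diff_singleton power_eq_if)
      also have "\<dots> \<le> bump 1 ((x $ i - p k) / m k) * (\<Prod>j\<in>UNIV - {i}. bump (?\<alpha> j) (x $ j))"
      proof (intro mult_mono prod_mono conjI)
        show "1/1000 \<le> bump 1 ((x $ i - p k) / m k)" using x by (intro bump_ge) auto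
        then show "0 \<le> bump 1 ((x $ i - p k) / m k)" by linarith
        show "1/1000 \<le> bump (?\<alpha> j) (x $ j)" if "j \<in> UNIV - {i}" for j
          using x(2)[of j] that by (intro bump_ge) auto
      qed (auto intro: prod_nonneg)
      finally have "(1/1000) ^ ?n * f k \<le> D ?\<alpha> x"
        unfolding D_in[OF k(1) kE] using f0[OF k(1)] mk by (simp add: mult.commute)
      also have "\<dots> \<le> \<bar>D ?\<alpha> x\<bar>" by simp
      also have "\<dots> \<le> grad_abs 1 D x"
        unfolding grad_abs_def by (rule member_le_sum) (auto intro: finite_multi_indices)
      finally show ?thesis using step_fn_in[OF I disE(2) k] f0[OF k(1)] by simp
    next
      case False
      then show ?thesis using step_fn_out[of I x E'] by auto
    qed
    then have "step_norm B I (\<lambda>k. (1/1000) ^ ?n * f k) (\<lambda>k. m k / real (4 ^ ?n)) \<le> rnorm B (grad_abs 1 D)"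
      using m0 by (intro rnorm_ge_step_norm[OF B I _ _ packE'] gm) auto
    then show ?thesis using step_norm_cmult[OF B I, of "\<lambda>k. m k / real (4 ^ ?n)" "(1/1000) ^ ?n"] m0 by simp
  qed
  \<comment> \<open>\<open>fin\<close> makes the sum of bumps admissible in the assumed
    inequality.\<close>
  have "rmem Z (D (\<lambda>_. 0))"
  proof -
    have "rnorm Z (D (\<lambda>_. 0)) < \<infinity>"
      using Zle fin by (auto intro!: le_less_trans[OF Zle] simp: ennreal_mult_less_top)
    then show ?thesis using Dm by (simp add: rmem_def)
  qed
  then have "ennreal ((1/1000) ^ ?n) * step_norm B I f (\<lambda>k. m k / real (4 ^ ?n))
    \<le> ennreal C * ennsqrt (ennreal (2 / l * 3 ^ ?n * P) * step_norm Y I a m)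
        * ennsqrt (ennreal (l * 3 ^ ?n) * step_norm Z I b m)"
    by (intro order_trans[OF Bge] order_trans[OF ineq[OF W21]] mult_mono ennsqrt_mono Yle Zle) auto
  also have "\<dots> = (ennreal C * ennreal (sqrt (2 / l * 3 ^ ?n * P)) * ennreal (sqrt (l * 3 ^ ?n)))
      * (ennsqrt (step_norm Y I a m) * ennsqrt (step_norm Z I b m))"
    using l P by (subst (1 2) ennsqrt_cmult) (auto simp: mult_ac)
  \<comment> \<open>The parameter l cancels, and the roots of the two factors \<open>3 ^ ?n\<close>
    combine to one such factor.\<close>
  also have "ennreal C * ennreal (sqrt (2 / l * 3 ^ ?n * P)) * ennreal (sqrt (l * 3 ^ ?n))
    = ennreal (3 ^ ?n * C * sqrt (2 * P))"
  proof -
    have "sqrt (2 / l * 3 ^ ?n * P) * sqrt (l * 3 ^ ?n) = sqrt ((3 ^ ?n)\<^sup>2 * (2 * P))"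
      unfolding real_sqrt_mult[symmetric] using l by (simp add: field_simps power2_eq_square)
    also have "\<dots> = 3 ^ ?n * sqrt (2 * P)" by (simp only: real_sqrt_mult real_sqrt_abs) simp
    finally have "C * sqrt (2 / l * 3 ^ ?n * P) * sqrt (l * 3 ^ ?n) = 3 ^ ?n * C * sqrt (2 * P)"
      by (simp add: mult_ac)
    then show ?thesis using C l P by (simp add: ennreal_mult[symmetric])
  qed
  finally have main: "ennreal ((1/1000) ^ ?n) * step_norm B I f (\<lambda>k. m k / real (4 ^ ?n))
    \<le> ennreal (3 ^ ?n * C * sqrt (2 * P)) * (ennsqrt (step_norm Y I a m) * ennsqrt (step_norm Z I b m))" .
  \<comment> \<open>Passing from the small cells back to the full measures m k costs 4 to the
    dimension.\<close>
  have "step_norm B I f m \<le> of_nat (4 ^ ?n) * step_norm B I f (\<lambda>k. m k / real (4 ^ ?n))"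
    by (rule step_norm_shrink[OF B I m0]) simp
  also have "\<dots> = ennreal (4000 ^ ?n) * (ennreal ((1/1000) ^ ?n) * step_norm B I f (\<lambda>k. m k / real (4 ^ ?n)))"
  proof -
    have "(4000::real) ^ ?n * (1/1000) ^ ?n = 4 ^ ?n" by (simp flip: power_mult_distrib)
    then have "ennreal (4000 ^ ?n) * ennreal ((1/1000) ^ ?n) = of_nat (4 ^ ?n)"
      by (simp flip: ennreal_mult ennreal_of_nat_eq_real_of_nat add: ennreal_of_nat_eq_real_of_nat)
    then show ?thesis by (simp only: mult.assoc[symmetric])
  qed
  also have "\<dots> \<le> ennreal (4000 ^ ?n) * (ennreal (3 ^ ?n * C * sqrt (2 * P)) *
      (ennsqrt (step_norm Y I a m) * ennsqrt (step_norm Z I b m)))"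
    by (intro mult_left_mono main) simp
  also have "\<dots> = ennreal (12000 ^ ?n * C * sqrt (2 * P)) * ennsqrt (step_norm Y I a m) * ennsqrt (step_norm Z I b m)"
  proof -
    have "(4000::real) ^ ?n * (3 ^ ?n * C * sqrt (2 * P)) = 12000 ^ ?n * C * sqrt (2 * P)"
      by (simp add: mult.assoc[symmetric] power_mult_distrib[symmetric])
    then have "ennreal (4000 ^ ?n) * ennreal (3 ^ ?n * C * sqrt (2 * P)) = ennreal (12000 ^ ?n * C * sqrt (2 * P))"
      using C P by (subst ennreal_mult[symmetric]) simp_all
    then show ?thesis by (simp only: mult.assoc[symmetric])
  qed
  finally show ?thesis by (simp add: f_def[abs_def] P_def)
qed

text \<open>Subdivide each step into pieces of the length required by \<open>interpolation_on_short_steps\<close>.\<close>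

lemma interpolation_on_steps:
  fixes Y Z B :: "(real \<Rightarrow> real) \<Rightarrow> ennreal" and C :: real and a b m :: "'k \<Rightarrow> real"
  assumes Y: "is_ri_bfs Y" and Z: "is_ri_bfs Z" and B: "is_ri_bfs B" and C: "C > 0"
    and ineq: "\<And>(u :: real^'n::finite \<Rightarrow> real) D. W21loc_with u D \<Longrightarrow> rmem Z u \<Longrightarrow>
        rnorm B (grad_abs 1 D) \<le> ennreal C * ennsqrt (rnorm Y (grad_abs 2 D)) * ennsqrt (rnorm Z u)"
    and I: "finite I" and pos: "\<forall>k\<in>I. 0 < m k \<and> 0 < a k \<and> 0 < b k"
    and fin: "step_norm Z I b m < \<infinity>"
  shows "step_norm B I (\<lambda>k. sqrt (a k * b k)) m
    \<le> ennreal (12000 ^ CARD('n) * C * sqrt (2 * real (card {\<alpha> :: 'n \<Rightarrow> nat. sum \<alpha> UNIV = 2})))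
        * ennsqrt (step_norm Y I a m) * ennsqrt (step_norm Z I b m)"
proof -
  have m0: "\<forall>k\<in>I. 0 \<le> m k" using pos by (auto simp: less_imp_le)
  \<comment> \<open>The ideal width of a bump for step k, divided by l.\<close>
  define r where "r k = sqrt (b k / a k)" for k
  have r: "0 < r k" if "k \<in> I" for k using pos that by (simp add: r_def)
  \<comment> \<open>This l keeps \<open>l * r k\<close> below both m k and 1 for every k;
    \<open>insert 1\<close> keeps the minimum defined when I is empty.\<close>
  define l where "l = Min (insert 1 ((\<lambda>k. min (m k) 1 / r k) ` I))"
  have l: "0 < l" unfolding l_def using I pos r by (subst Min_gr_iff) auto
  have lr: "l * r k \<le> m k" "l * r k \<le> 1" if k: "k \<in> I" for k
  proof -
    have "l \<le> min (m k) 1 / r k" unfolding l_def using I k by (intro Min_le) auto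
    then have "l * r k \<le> min (m k) 1" using r[OF k] by (simp add: pos_le_divide_eq)
    then show "l * r k \<le> m k" "l * r k \<le> 1" by auto
  qed
  \<comment> \<open>The number of pieces of width about \<open>l * r k\<close>. Rounding up at most
    doubles the quotient, as it is at least 1.\<close>
  define L where "L k = nat \<lceil>m k / (l * r k)\<rceil>" for k
  have L: "m k / (l * r k) \<le> real (L k)" "real (L k) \<le> 2 * (m k / (l * r k))" "0 < L k" if k: "k \<in> I" for k
  proof -
    define q where "q = m k / (l * r k)"
    have "1 \<le> q" unfolding q_def using lr(1)[OF k] l r[OF k] by simp
    then have "q \<le> real (nat \<lceil>q\<rceil>)" "real (nat \<lceil>q\<rceil>) \<le> 2 * q" "0 < nat \<lceil>q\<rceil>"
      by linarith+
    then show "m k / (l * r k) \<le> real (L k)" "real (L k) \<le> 2 * (m k / (l * r k))" "0 < L k"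
      unfolding L_def q_def .
  qed
  have short: "m k / real (L k) \<le> l * r k" "l * r k \<le> 2 * (m k / real (L k))" if k: "k \<in> I" for k
    using L[OF k] l r[OF k] by (simp_all add: field_simps)
  have rb: "r k * sqrt (a k * b k) = b k" "a k * r k = sqrt (a k * b k)" if k: "k \<in> I" for k
  proof -
    have p: "0 < a k" "0 < b k" using pos k by auto
    have "r k * sqrt (a k * b k) = sqrt ((b k)\<^sup>2)"
      unfolding r_def real_sqrt_mult[symmetric] using p by (simp add: power2_eq_square)
    then show "r k * sqrt (a k * b k) = b k" using p by simp
    have "a k * r k = sqrt ((a k)\<^sup>2 * (b k / a k))"
      unfolding r_def using p by (simp only: real_sqrt_mult real_sqrt_abs)
    then show "a k * r k = sqrt (a k * b k)" using p by (simp add: power2_eq_square)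
  qed
  let ?I = "SIGMA k:I. {..<L k}" and ?m = "\<lambda>x. m (fst x) / real (L (fst x))"
  have Lpos: "\<forall>k\<in>I. 0 < L k" using L by auto
  note refine = step_norm_refine[OF _ I m0 Lpos]
  have "step_norm B ?I (\<lambda>x. sqrt (a (fst x) * b (fst x))) ?m
    \<le> ennreal (12000 ^ CARD('n) * C * sqrt (2 * real (card {\<alpha> :: 'n \<Rightarrow> nat. sum \<alpha> UNIV = 2})))
        * ennsqrt (step_norm Y ?I (\<lambda>x. a (fst x)) ?m) * ennsqrt (step_norm Z ?I (\<lambda>x. b (fst x)) ?m)"
  proof (rule interpolation_on_short_steps[OF Y Z B C ineq])
    show "\<forall>x\<in>?I. ?m x \<le> 1"
    proof
      fix x assume "x \<in> ?I"
      then have k: "fst x \<in> I" by auto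
      show "?m x \<le> 1" using short(1)[OF k] lr(2)[OF k] by linarith
    qed
    show "\<forall>x\<in>?I. ?m x * sqrt (a (fst x) * b (fst x)) \<le> l * b (fst x)"
    proof
      fix x assume "x \<in> ?I"
      then have k: "fst x \<in> I" by auto
      have "?m x * sqrt (a (fst x) * b (fst x)) \<le> l * r (fst x) * sqrt (a (fst x) * b (fst x))"
        using short(1)[OF k] pos k by (intro mult_right_mono) (auto simp: less_imp_le)
      then show "?m x * sqrt (a (fst x) * b (fst x)) \<le> l * b (fst x)"
        using rb(1)[OF k] by (simp add: mult.assoc)
    qed
    show "\<forall>x\<in>?I. sqrt (a (fst x) * b (fst x)) \<le> 2 / l * a (fst x) * ?m x"
    proof
      fix x assume "x \<in> ?I"
      then have k: "fst x \<in> I" by auto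
      have "a (fst x) / l * (l * r (fst x)) \<le> a (fst x) / l * (2 * ?m x)"
        using short(2)[OF k] pos k l by (intro mult_left_mono) (auto simp: less_imp_le)
      then show "sqrt (a (fst x) * b (fst x)) \<le> 2 / l * a (fst x) * ?m x"
        using rb(2)[OF k] l by (simp add: mult_ac)
    qed
    show "\<forall>x\<in>?I. 0 < ?m x \<and> 0 < a (fst x) \<and> 0 < b (fst x)" using pos Lpos by auto
  qed (use I l fin refine[OF Z] in auto)
  then show ?thesis by (simp only: refine[OF Y] refine[OF Z] refine[OF B, of "\<lambda>k. sqrt (a k * b k)"])
qed

text \<open>The steps are the sets where the pair (G, H) is constant. Pairs with a zero entry do not
  contribute to the product, null sets are dropped to have positive measures, and
  \<open>supp\<close> makes the remaining measures finite.\<close>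

lemma interpolation_on_simple_functions:
  fixes Y Z B :: "(real \<Rightarrow> real) \<Rightarrow> ennreal" and C :: real
  assumes Y: "is_ri_bfs Y" and Z: "is_ri_bfs Z" and B: "is_ri_bfs B" and C: "C > 0"
    and ineq: "\<And>(u :: real^'n::finite \<Rightarrow> real) D. W21loc_with u D \<Longrightarrow> rmem Z u \<Longrightarrow>
        rnorm B (grad_abs 1 D) \<le> ennreal C * ennsqrt (rnorm Y (grad_abs 2 D)) * ennsqrt (rnorm Z u)"
    and G: "simple_function M0 G" "\<And>x. 0 \<le> G x" and H: "simple_function M0 H" "\<And>x. 0 \<le> H x"
    and supp: "emeasure M0 {x \<in> space M0. G x \<noteq> 0} < \<infinity>"
    and fin: "Z H < \<infinity>"
  shows "B (\<lambda>x. sqrt (G x) * sqrt (H x))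
    \<le> ennreal (12000 ^ CARD('n) * C * sqrt (2 * real (card {\<alpha> :: 'n \<Rightarrow> nat. sum \<alpha> UNIV = 2})))
        * ennsqrt (Y G) * ennsqrt (Z H)"
proof -
  define E where "E ab = {x \<in> space M0. G x = fst ab \<and> H x = snd ab}" for ab
  define J where "J = {ab \<in> G ` space M0 \<times> H ` space M0. 0 < fst ab \<and> 0 < snd ab}"
  define I where "I = {ab \<in> J. emeasure M0 (E ab) \<noteq> 0}"
  define m where "m ab = measure M0 (E ab)" for ab
  have Gm: "G \<in> borel_measurable M0" and Hm: "H \<in> borel_measurable M0"
    using G H by (auto intro: borel_measurable_simple_function)
  have J: "finite J"
    using G H by (auto simp: J_def simple_function_def intro: finite_subset[of _ "G ` space M0 \<times> H ` space M0"])
  have I: "finite I" using J by (simp add: I_def)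
  have Es: "E ab \<in> sets M0" for ab
  proof -
    have "E ab = (G -` {fst ab} \<inter> space M0) \<inter> (H -` {snd ab} \<inter> space M0)" by (auto simp: E_def)
    then show ?thesis using simple_functionD(2)[OF G(1)] simple_functionD(2)[OF H(1)] by (metis sets.Int)
  qed
  have Efin: "emeasure M0 (E ab) < \<infinity>" if "ab \<in> J" for ab
  proof -
    have "emeasure M0 (E ab) \<le> emeasure M0 {x \<in> space M0. G x \<noteq> 0}"
    proof (intro emeasure_mono)
      have "{x \<in> space M0. G x \<noteq> 0} = space M0 - (G -` {0} \<inter> space M0)" by auto
      then show "{x \<in> space M0. G x \<noteq> 0} \<in> sets M0"
        using sets.compl_sets[OF simple_functionD(2)[OF G(1)]] by metis
    qed (use that in \<open>auto simp: E_def J_def\<close>)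
    then show ?thesis using supp by (rule le_less_trans)
  qed
  have mE: "emeasure M0 (E ab) = ennreal (m ab)" if "ab \<in> J" for ab
    using Efin[OF that] by (simp add: m_def emeasure_eq_ennreal_measure less_top[symmetric])
  have mpos: "0 < m ab" if "ab \<in> I" for ab
    using that mE[of ab] by (auto simp: I_def m_def zero_less_measure_iff)
  have pos: "\<forall>ab\<in>I. 0 < m ab \<and> 0 < fst ab \<and> 0 < snd ab" using mpos by (auto simp: I_def J_def)
  have m0: "\<forall>ab\<in>I. 0 \<le> m ab" by (simp add: m_def)
  have pE: "packing M0 I m E"
    using Es mE by (auto simp: packing_def disjoint_family_on_def I_def E_def)
  have dis: "disjoint_family_on E I" using pE by (simp add: packing_def)
  have stepY: "step_norm Y I fst m \<le> Y G"
    unfolding step_norm_eq[OF Y I m0 pE, symmetric]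
  proof (intro bfs_mono[OF Y] borel_measurable_step_fn[OF pE] Gm AE_I2)
    fix x assume "x \<in> space M0"
    show "\<bar>step_fn I fst E x\<bar> \<le> \<bar>G x\<bar>"
    proof (cases "\<exists>ab\<in>I. x \<in> E ab")
      case True
      then obtain ab where "ab \<in> I" "x \<in> E ab" by blast
      moreover have "x \<in> E ab \<Longrightarrow> G x = fst ab \<and> H x = snd ab" by (simp add: E_def)
      ultimately show ?thesis using step_fn_in[OF I dis, of ab x] by simp
    qed (auto simp: step_fn_out)
  qed
  have stepZ: "step_norm Z I snd m \<le> Z H"
    unfolding step_norm_eq[OF Z I m0 pE, symmetric]
  proof (intro bfs_mono[OF Z] borel_measurable_step_fn[OF pE] Hm AE_I2)
    fix x assume "x \<in> space M0"
    show "\<bar>step_fn I snd E x\<bar> \<le> \<bar>H x\<bar>"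
    proof (cases "\<exists>ab\<in>I. x \<in> E ab")
      case True
      then obtain ab where "ab \<in> I" "x \<in> E ab" by blast
      moreover have "x \<in> E ab \<Longrightarrow> G x = fst ab \<and> H x = snd ab" by (simp add: E_def)
      ultimately show ?thesis using step_fn_in[OF I dis, of ab x] by simp
    qed (auto simp: step_fn_out)
  qed
  \<comment> \<open>Only finitely many level sets are dropped as null, so the product is unchanged
    almost everywhere.\<close>
  have "AE x in M0. \<forall>ab\<in>J - I. x \<notin> E ab"
  proof (rule eventually_ball_finite)
    show "\<forall>ab\<in>J - I. AE x in M0. x \<notin> E ab"
      using Es by (auto simp: I_def intro!: AE_not_in null_setsI)
  qed (use J in simp)
  then have "AE x in M0. \<bar>sqrt (G x) * sqrt (H x)\<bar> \<le> \<bar>step_fn I (\<lambda>ab. sqrt (fst ab * snd ab)) E x\<bar>"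
  proof (rule AE_mp, intro AE_I2 impI)
    fix x assume x: "x \<in> space M0" and null: "\<forall>ab\<in>J - I. x \<notin> E ab"
    show "\<bar>sqrt (G x) * sqrt (H x)\<bar> \<le> \<bar>step_fn I (\<lambda>ab. sqrt (fst ab * snd ab)) E x\<bar>"
    proof (cases "G x = 0 \<or> H x = 0")
      case False
      then have "0 < G x" "0 < H x" using G(2)[of x] H(2)[of x] by auto
      then have "(G x, H x) \<in> J" using x by (auto simp: J_def)
      moreover have xE: "x \<in> E (G x, H x)" using x by (simp add: E_def)
      ultimately have "(G x, H x) \<in> I" using null by blast
      from step_fn_in[OF I dis this xE] show ?thesis by (simp add: real_sqrt_mult)
    qed auto
  qed
  then have "B (\<lambda>x. sqrt (G x) * sqrt (H x)) \<le> B (step_fn I (\<lambda>ab. sqrt (fst ab * snd ab)) E)"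
    by (intro bfs_mono[OF B] borel_measurable_step_fn[OF pE]) (use Gm Hm in measurable)
  also have "\<dots> = step_norm B I (\<lambda>ab. sqrt (fst ab * snd ab)) m"
    by (rule step_norm_eq[OF B I m0 pE])
  also have "\<dots> \<le> ennreal (12000 ^ CARD('n) * C * sqrt (2 * real (card {\<alpha> :: 'n \<Rightarrow> nat. sum \<alpha> UNIV = 2})))
        * ennsqrt (step_norm Y I fst m) * ennsqrt (step_norm Z I snd m)"
    by (rule interpolation_on_steps[OF Y Z B C ineq I pos le_less_trans[OF stepZ fin]])
  also have "\<dots> \<le> ennreal (12000 ^ CARD('n) * C * sqrt (2 * real (card {\<alpha> :: 'n \<Rightarrow> nat. sum \<alpha> UNIV = 2})))
        * ennsqrt (Y G) * ennsqrt (Z H)"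
    by (intro mult_mono ennsqrt_mono stepY stepZ) auto
  finally show ?thesis .
qed

section \<open>Passage from simple functions to general g and h\<close>

lemma simple_function_approx_real:
  fixes g :: "'a \<Rightarrow> real"
  assumes "g \<in> borel_measurable M" "\<And>x. 0 \<le> g x"
  shows "\<exists>s. \<forall>n. simple_function M (s n) \<and> (\<forall>x. 0 \<le> s n x \<and> s n x \<le> s (Suc n) x \<and> s n x \<le> g x \<and> (\<lambda>n. s n x) \<longlonglongrightarrow> g x)"
proof -
  obtain s where s: "incseq s" "\<And>n. simple_function M (s n)" "\<And>x. bdd_above (range (\<lambda>n. s n x))"
    "\<And>n x. 0 \<le> s n x" "g = (SUP n. s n)"
    using borel_measurable_implies_simple_function_sequence_real[OF assms] by blast
  have inc: "incseq (\<lambda>n. s n x)" for x using s(1) by (auto simp: incseq_def le_fun_def)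
  have g: "g x = (SUP n. s n x)" for x unfolding s(5) by (simp add: image_image)
  have "s n x \<le> g x" for n x unfolding g using s(3) by (intro cSUP_upper) auto
  moreover have "(\<lambda>n. s n x) \<longlonglongrightarrow> g x" for x unfolding g by (rule LIMSEQ_incseq_SUP[OF s(3) inc])
  moreover have "s n x \<le> s (Suc n) x" for n x using incseq_SucD[OF inc] .
  ultimately show ?thesis using s(2,4) by blast
qed

text \<open>For simple functions increasing to g and h the products are bounded in B uniformly in n.
  The Fatou property carries the bound to sqrt g * sqrt h, and the ideal property to f. Both parts
  of the theorem ask for this membership in B.\<close>

lemma bfs_mem_of_CL_mem:
  fixes Y Z B :: "(real \<Rightarrow> real) \<Rightarrow> ennreal" and C :: real
  assumes Y: "is_ri_bfs Y" and Z: "is_ri_bfs Z" and B: "is_ri_bfs B" and C: "C > 0"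
    and ineq: "\<And>(u :: real^'n::finite \<Rightarrow> real) D. W21loc_with u D \<Longrightarrow> rmem Z u \<Longrightarrow>
        rnorm B (grad_abs 1 D) \<le> ennreal C * ennsqrt (rnorm Y (grad_abs 2 D)) * ennsqrt (rnorm Z u)"
    and f: "CL_mem Y Z f"
  shows "bfs_mem B f"
proof -
  obtain g' h' where f: "f \<in> borel_measurable M0" and g': "bfs_mem Y g'" and h': "bfs_mem Z h'"
    and nonneg: "\<And>x. x \<in> {0<..} \<Longrightarrow> 0 \<le> g' x \<and> 0 \<le> h' x"
    and fle: "AE x in M0. \<bar>f x\<bar> \<le> sqrt (g' x) * sqrt (h' x)"
    using f unfolding CL_mem_def by blast
  \<comment> \<open>The given factors are nonnegative only on the half-line; the approximation by
    simple functions asks for nonnegativity everywhere.\<close>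
  define g where "g x = \<bar>g' x\<bar>" for x
  define h where "h x = \<bar>h' x\<bar>" for x
  have gm: "g \<in> borel_measurable M0" and hm: "h \<in> borel_measurable M0"
    using g' h' by (auto simp: g_def[abs_def] h_def[abs_def] bfs_mem_def)
  have "Y g \<le> Y g'" "Z h \<le> Z h'"
    using g' h' gm hm by (auto intro!: bfs_mono[OF Y] bfs_mono[OF Z] simp: bfs_mem_def g_def h_def)
  then have fin: "Y g < \<infinity>" "Z h < \<infinity>" using g' h' unfolding bfs_mem_def by (auto intro: le_less_trans)
  obtain s where s: "\<And>n. simple_function M0 (s n)"
    "\<And>n x. 0 \<le> s n x" "\<And>n x. s n x \<le> s (Suc n) x" "\<And>n x. s n x \<le> g x" "\<And>x. (\<lambda>n. s n x) \<longlonglongrightarrow> g x"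
    using simple_function_approx_real[OF gm] by (auto simp: g_def)
  obtain H where H: "\<And>n. simple_function M0 (H n)"
    "\<And>n x. 0 \<le> H n x" "\<And>n x. H n x \<le> H (Suc n) x" "\<And>n x. H n x \<le> h x" "\<And>x. (\<lambda>n. H n x) \<longlonglongrightarrow> h x"
    using simple_function_approx_real[OF hm] by (auto simp: h_def)
  \<comment> \<open>The cutoff gives the support finite measure, and G n still increases to g on the
    half-line.\<close>
  define G where "G n x = s n x * indicat_real {0<..real n} x" for n x
  have Gs: "simple_function M0 (G n)" for n
  proof -
    have "{0<..real n} \<in> sets M0" by (auto simp: sets_restrict_space_iff)
    then have "simple_function M0 (indicat_real {0<..real n})" by (rule simple_function_indicator)
    then show ?thesis unfolding G_def[abs_def] using s(1) by (intro simple_function_mult)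
  qed
  have G: "0 \<le> G n x" "G n x \<le> G (Suc n) x" "G n x \<le> g x" for n x
    using s(2)[of n x] s(3)[where n=n and x=x] s(4)[of n x] order_trans[OF s(2)[of n x] s(4)[of n x]]
    by (auto simp: G_def indicator_def)
  have Glim: "(\<lambda>n. G n x) \<longlonglongrightarrow> g x" if "0 < x" for x
  proof (rule Lim_transform_eventually[OF s(5)])
    obtain N :: nat where "x \<le> real N" using real_arch_simple by blast
    then have "\<forall>n\<ge>N. s n x = G n x" using that by (auto simp: G_def indicator_def)
    then show "\<forall>\<^sub>F n in sequentially. s n x = G n x" by (auto simp: eventually_sequentially)
  qed
  define K where "K = ennreal (12000 ^ CARD('n) * C * sqrt (2 * real (card {\<alpha> :: 'n \<Rightarrow> nat. sum \<alpha> UNIV = 2})))"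
  have bound: "B (\<lambda>x. sqrt (G n x) * sqrt (H n x)) \<le> K * ennsqrt (Y g) * ennsqrt (Z h)" for n
  proof -
    have Gmn: "G n \<in> borel_measurable M0" "H n \<in> borel_measurable M0"
      using Gs H(1) by (auto intro: borel_measurable_simple_function)
    have YG: "Y (G n) \<le> Y g" "Z (H n) \<le> Z h"
      using G H gm hm Gmn by (auto intro!: bfs_mono[OF Y] bfs_mono[OF Z] simp: g_def h_def)
    have "emeasure M0 {x \<in> space M0. G n x \<noteq> 0} \<le> emeasure M0 {0<..real n}"
      by (intro emeasure_mono) (auto simp: G_def indicator_def sets_restrict_space_iff split: if_splits)
    also have "\<dots> < \<infinity>" by (subst emeasure_M0) auto
    finally have "B (\<lambda>x. sqrt (G n x) * sqrt (H n x)) \<le> K * ennsqrt (Y (G n)) * ennsqrt (Z (H n))"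
      unfolding K_def using G(1) H(2) le_less_trans[OF YG(2) fin(2)]
      by (intro interpolation_on_simple_functions[OF Y Z B C ineq Gs _ H(1)]) auto
    also have "\<dots> \<le> K * ennsqrt (Y g) * ennsqrt (Z h)"
      by (intro mult_mono ennsqrt_mono YG) auto
    finally show ?thesis .
  qed
  have "B (\<lambda>x. sqrt (g x) * sqrt (h x)) = (SUP n. B (\<lambda>x. sqrt (G n x) * sqrt (H n x)))"
  proof (rule bfs_Fatou[OF B])
    show "(\<lambda>x. sqrt (G n x) * sqrt (H n x)) \<in> borel_measurable M0" for n
      using borel_measurable_simple_function[OF Gs[of n]] borel_measurable_simple_function[OF H(1)[of n]]
      by measurable
    show "(\<lambda>x. sqrt (g x) * sqrt (h x)) \<in> borel_measurable M0" using gm hm by measurable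
    show "AE x in M0. (\<forall>n. 0 \<le> sqrt (G n x) * sqrt (H n x) \<and>
        sqrt (G n x) * sqrt (H n x) \<le> sqrt (G (Suc n) x) * sqrt (H (Suc n) x)) \<and>
      (\<lambda>n. sqrt (G n x) * sqrt (H n x)) \<longlonglongrightarrow> sqrt (g x) * sqrt (h x)"
      using G H Glim
      by (intro AE_I2 conjI allI mult_mono tendsto_mult tendsto_real_sqrt) auto
  qed
  also have "\<dots> \<le> K * ennsqrt (Y g) * ennsqrt (Z h)" by (intro SUP_least bound)
  also have "\<dots> < \<infinity>"
    using ennsqrt_less_top[OF fin(1)] ennsqrt_less_top[OF fin(2)]
    by (simp add: ennreal_mult_less_top K_def)
  finally have "B (\<lambda>x. sqrt (g x) * sqrt (h x)) < \<infinity>" .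
  moreover have "B f \<le> B (\<lambda>x. sqrt (g x) * sqrt (h x))"
  proof (rule bfs_mono[OF B f])
    show "(\<lambda>x. sqrt (g x) * sqrt (h x)) \<in> borel_measurable M0" using gm hm by measurable
    show "AE x in M0. \<bar>f x\<bar> \<le> \<bar>sqrt (g x) * sqrt (h x)\<bar>"
      using fle by (rule AE_mp) (use nonneg in \<open>auto simp: g_def h_def intro!: AE_I2\<close>)
  qed
  ultimately show ?thesis using f by (simp add: bfs_mem_def le_less_trans)
qed

theorem theorem2p2:
  fixes Y Z B :: "(real \<Rightarrow> real) \<Rightarrow> ennreal" and C :: real
  assumes Y: "is_ri_bfs Y" and Z: "is_ri_bfs Z" and B: "is_ri_bfs B"
    and C: "C > 0"
    and ineq: "\<And>(u :: real^'n::finite \<Rightarrow> real) D. W21loc_with u D \<Longrightarrow> rmem Z u \<Longrightarrow>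
        rnorm B (grad_abs 1 D) \<le> ennreal C * ennsqrt (rnorm Y (grad_abs 2 D)) * ennsqrt (rnorm Z u)"
  shows "((\<forall>f. bfs_mem Z f \<and> Linf_mem f \<longrightarrow> bfs_mem Y f) \<longrightarrow>
            (\<forall>f. CL_mem Y Z f \<and> Linf_mem f \<longrightarrow> bfs_mem B f))
       \<and> ((\<forall>f. bfs_mem Z f \<and> L1_mem f \<longrightarrow> bfs_mem Y f) \<longrightarrow>
            (\<forall>f. CL_mem Y Z f \<and> L1_mem f \<longrightarrow> bfs_mem B f))"
  using bfs_mem_of_CL_mem[OF Y Z B C ineq] by blast

end
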